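(* Let $d\in\mathbb{N}$, $d\ge 1$. If $\Delta\subseteq[0,d]$ is a nonempty $\mathcal{F}_\sigma$ set (a countable union of closed sets) which contains its infimum and its supremum, then there exists a compact set $F\subseteq[0,1]^d$ such that \[ \{\dim_{\mathrm{H}} E: E\in\mathcal{G}_F\}=\Delta . \]
   Context: $\dim_{\mathrm{H}}$ denotes Hausdorff dimension. Let $X=[0,1]^d$ and let $\mathcal{K}(X)$ be the space of nonempty compact subsets of $X$ with the Hausdorff metric. A set $D\in\mathcal{K}(X)$ is a miniset of a compact set $F\subset\mathbb{R}^d$ if $D=(\lambda F+t)\cap X$ for some $\lambda\ge 1$ and $t\in\mathbb{R}^d$. A set $E\in\mathcal{K}(X)$ is a microset of $F$ if it is a limit, in the Hausdorff metric, of a sequence of minisets of $F$ (the scaling coefficients $\lambda$ are not required to be unbounded along the sequence). The gallery $\mathcal{G}_F$ is the collection of all microsets of $F$ which intersect the interior $(0,1)^d$ of $X$. *)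

theory Defs
  imports "HOL-Analysis.Analysis"
begin

text \<open>
  The contribution of a covering set to the $s$-dimensional Hausdorff measure. The exponent
  $0$ is treated separately because \<open>0 powr 0 = 0\<close>: a nonempty set contributes $1$ to the
  $0$-dimensional (counting) measure, also if it is a single point. The empty set never
  contributes.
\<close>

definition gauge_diam :: "real \<Rightarrow> 'a::metric_space set \<Rightarrow> real" where
  "gauge_diam s U = (if U = {} then 0 else if s = 0 then 1 else diameter U powr s)"

text \<open>
  The library's \<open>diameter\<close> is meaningful for bounded sets only, so boundedness is part of the
  condition on a \<open>\<delta>\<close>-cover. Finite covers are included, since \<open>U i\<close> may be empty.
\<close>

definition delta_cover :: "real \<Rightarrow> 'a::metric_space set \<Rightarrow> (nat \<Rightarrow> 'a set) \<Rightarrow> bool" where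
  "delta_cover \<delta> A U \<longleftrightarrow> A \<subseteq> (\<Union>i. U i) \<and> (\<forall>i. bounded (U i) \<and> diameter (U i) \<le> \<delta>)"

definition hausdorff_premeasure :: "real \<Rightarrow> real \<Rightarrow> 'a::metric_space set \<Rightarrow> ennreal" where
  "hausdorff_premeasure s \<delta> A = (INF U \<in> {U. delta_cover \<delta> A U}. \<Sum>i. ennreal (gauge_diam s (U i)))"

definition hausdorff_measure :: "real \<Rightarrow> 'a::metric_space set \<Rightarrow> ennreal" where
  "hausdorff_measure s A = (SUP \<delta> \<in> {0<..}. hausdorff_premeasure s \<delta> A)"

text \<open>Extended-real valued, so that the infimum of the empty set is \<open>\<infinity>\<close>.\<close>

definition hausdorff_dim :: "'a::metric_space set \<Rightarrow> ereal" where
  "hausdorff_dim A = (INF s \<in> {s. 0 \<le> s \<and> hausdorff_measure s A = 0}. ereal s)"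

text \<open>The Hausdorff metric; used for nonempty compact sets, for which the suprema are finite.\<close>

definition hausdorff_dist :: "'a::metric_space set \<Rightarrow> 'a set \<Rightarrow> real" where
  "hausdorff_dist A B = max (SUP a\<in>A. infdist a B) (SUP b\<in>B. infdist b A)"

abbreviation unit_cube :: "(real ^ 'n) set" where
  "unit_cube \<equiv> cbox 0 1"

definition hyperspace :: "'a::topological_space set \<Rightarrow> 'a set set" where
  "hyperspace X = {D. D \<noteq> {} \<and> compact D \<and> D \<subseteq> X}"

definition minisets :: "(real ^ 'n) set \<Rightarrow> (real ^ 'n) set set" where
  "minisets F = {D \<in> hyperspace unit_cube.
     \<exists>c t. 1 \<le> c \<and> D = (\<lambda>x. c *\<^sub>R x + t) ` F \<inter> unit_cube}"

definition microsets :: "(real ^ 'n) set \<Rightarrow> (real ^ 'n) set set" where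
  "microsets F = {E \<in> hyperspace unit_cube.
     \<exists>D :: nat \<Rightarrow> (real ^ 'n) set. (\<forall>k. D k \<in> minisets F) \<and>
       (\<lambda>k. hausdorff_dist (D k) E) \<longlonglongrightarrow> 0}"

definition gallery :: "(real ^ 'n) set \<Rightarrow> (real ^ 'n) set set" where
  "gallery F = {E \<in> microsets F. E \<inter> interior unit_cube \<noteq> {}}"

end

theory Submission
  imports Defs "HOL-Library.Diagonal_Subsequence"
begin

text \<open>
  The set \<open>F\<close> is a product of identical digit sets. Fix a sequence \<open>w\<close> of booleans and let
  \<open>digit_set w\<close> consist of the points all of whose coordinates have a binary expansion with digit
  \<open>1\<close> only at places \<open>l\<close> where \<open>w l\<close> holds. At every scale \<open>2\<^sup>-\<^sup>m\<close> all pieces of this set are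
  translates of one another: each is a copy of the digit set of the shifted sequence \<open>shift m w\<close>.
  A microset that meets the open cube is therefore covered by boundedly many limits of such
  pieces and contains one of them up to similarity, and all of these are copies of
  \<open>digit_set w'\<close> for one and the same limit \<open>w'\<close> of shifts of \<open>w\<close>. The pieces that a microset
  catches on the boundary of the cube thus cannot spoil its dimension
  (\<open>zoom.limit_dimension\<close>), which is \<open>d\<close> times the lower density of \<open>w'\<close>, the lower limit of the
  frequencies of \<open>True\<close>. Conversely every limit of shifts occurs, by
  zooming in at the corner of the cube (\<open>gallery_digit_set_attains\<close>).

  What remains is a problem on sequences: find one \<open>w\<close> such that the lower densities of
  all limits of its shifts form the set \<open>\<Delta> / d\<close> (\<open>sequence_with_limit_densities\<close>). Write
  \<open>\<Delta> / d = (\<Union>p. K p)\<close> with compact \<open>K p\<close>, with infimum \<open>\<alpha>\<close> and supremum \<open>\<beta>\<close>, and let \<open>w\<close> be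
  the sequence of jumps of \<open>\<lfloor>height m\<rfloor>\<close> for a function \<open>height\<close> with slopes in \<open>[\<alpha>, \<beta>]\<close>;
  rounding costs at most \<open>1\<close> on every window. The function is made of longer and
  longer words; word \<open>j\<close> is periodic with a period \<open>n j\<close> on which the slope is first \<open>\<alpha>\<close>
  and then \<open>\<beta>\<close> so that the mean slope is \<open>s j \<in> K (n j)\<close>. Every pair \<open>(p, t)\<close> with \<open>t \<in> K p\<close> is
  approximated infinitely often by \<open>(n j, s j)\<close>. A limit of shifts that stays
  in words of bounded period has a mean slope in one of the closed sets \<open>K p\<close>. If the
  periods tend to infinity, the limit sees at most two changes of slope and so has density
  \<open>\<alpha>\<close> or \<open>\<beta>\<close>. This is where the hypotheses on \<open>\<Delta>\<close> enter: closedness of the single \<open>K p\<close> in the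
  first case, the presence of the infimum and the supremum in the second. The shifts of \<open>w\<close>
  itself have lower density \<open>\<alpha>\<close>, since each word is much longer than all words before it.

  The dimension is computed from counting alone. The upper bound uses the dyadic covers. The
  lower bound is a mass distribution principle in which finite families of points replace the
  measure (\<open>mass_distribution_principle\<close>).
\<close>

section \<open>Hausdorff measure and dimension\<close>

lemma hausdorff_measure_eq_0I:
  assumes "\<And>\<delta> \<epsilon>. 0 < \<delta> \<Longrightarrow> 0 < \<epsilon> \<Longrightarrow>
    \<exists>U. delta_cover \<delta> A U \<and> (\<Sum>i. ennreal (gauge_diam s (U i))) \<le> ennreal \<epsilon>"
  shows "hausdorff_measure s A = 0"
proof -
  have "hausdorff_premeasure s \<delta> A \<le> 0" if "0 < \<delta>" for \<delta>
  proof (rule ennreal_le_epsilon)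
    fix e :: real assume "0 < e"
    with assms[OF that] obtain U where "delta_cover \<delta> A U"
      "(\<Sum>i. ennreal (gauge_diam s (U i))) \<le> ennreal e" by blast
    then show "hausdorff_premeasure s \<delta> A \<le> 0 + ennreal e"
      unfolding hausdorff_premeasure_def by (auto intro: INF_lower2)
  qed
  then show ?thesis
    unfolding hausdorff_measure_def by (intro antisym SUP_least) auto
qed

lemma hausdorff_measure_eq_0D:
  assumes "hausdorff_measure s A = 0" "0 < \<delta>" "0 < \<epsilon>"
  obtains U where "delta_cover \<delta> A U" "(\<Sum>i. ennreal (gauge_diam s (U i))) < ennreal \<epsilon>"
proof -
  have "hausdorff_premeasure s \<delta> A \<le> hausdorff_measure s A"
    unfolding hausdorff_measure_def using assms(2) by (intro SUP_upper) auto
  then have "hausdorff_premeasure s \<delta> A < ennreal \<epsilon>"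
    using assms by simp
  then show ?thesis
    unfolding hausdorff_premeasure_def INF_less_iff using that by blast
qed

lemma gauge_diam_le:
  assumes "0 < s" "bounded U" "diameter U \<le> x"
  shows "gauge_diam s U \<le> x powr s"
  using assms diameter_ge_0[OF assms(2)] by (auto simp: gauge_diam_def intro!: powr_mono2)

text \<open>
  Covers are needed at infinitely many scales only; for this reason the lower, and not the
  upper, growth rate of the covering numbers bounds the dimension.
\<close>

lemma hausdorff_measure_eq_0_of_covers:
  fixes A :: "'a::metric_space set"
  assumes "0 < s" "t < s" "0 \<le> c" "0 \<le> K"
    and cov: "\<exists>\<^sub>F m in sequentially. \<exists>\<U>. finite \<U> \<and> A \<subseteq> \<Union>\<U> \<and>
        (\<forall>U\<in>\<U>. bounded U \<and> diameter U \<le> c / 2 ^ m) \<and> real (card \<U>) \<le> K * 2 powr (t * real m)"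
  shows "hausdorff_measure s A = 0"
proof (rule hausdorff_measure_eq_0I)
  fix \<delta> \<epsilon> :: real assume "0 < \<delta>" "0 < \<epsilon>"
  have "(\<lambda>m. c * (1/2) ^ m) \<longlonglongrightarrow> c * 0"
    by (intro tendsto_intros) auto
  then have "\<forall>\<^sub>F m in sequentially. c * (1/2) ^ m < \<delta>"
    using \<open>0 < \<delta>\<close> by (intro order_tendstoD(2)) auto
  moreover have "(\<lambda>m. K * c powr s * (2 powr (t - s)) ^ m) \<longlonglongrightarrow> K * c powr s * 0"
    using powr_less_one[of 2 "t - s"] \<open>t < s\<close>
    by (intro tendsto_mult tendsto_const LIMSEQ_power_zero) simp
  then have "\<forall>\<^sub>F m in sequentially. K * c powr s * (2 powr (t - s)) ^ m < \<epsilon>"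
    using \<open>0 < \<epsilon>\<close> by (intro order_tendstoD(2)) auto
  ultimately have "\<forall>\<^sub>F m in sequentially. c * (1/2) ^ m < \<delta> \<and> K * c powr s * (2 powr (t - s)) ^ m < \<epsilon>"
    by (rule eventually_conj)
  from frequently_eventually_frequently[OF cov this, THEN frequently_ex]
  obtain m \<U> where m: "c * (1/2) ^ m < \<delta>" "K * c powr s * (2 powr (t - s)) ^ m < \<epsilon>"
    and \<U>: "finite \<U>" "A \<subseteq> \<Union>\<U>" "\<And>U. U \<in> \<U> \<Longrightarrow> bounded U" "\<And>U. U \<in> \<U> \<Longrightarrow> diameter U \<le> c / 2 ^ m"
      "real (card \<U>) \<le> K * 2 powr (t * real m)"
    by blast
  obtain h where h: "bij_betw h {0..<card \<U>} \<U>"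
    using ex_bij_betw_nat_finite[OF \<U>(1)] by blast
  define U where "U i = (if i < card \<U> then h i else {})" for i
  have U_in: "U i \<in> \<U>" if "i < card \<U>" for i
    using h that by (auto simp: U_def bij_betw_def)
  have cm: "c / 2 ^ m = c * (1/2) ^ m" by (simp add: power_one_over field_simps)
  have "A \<subseteq> (\<Union>i. U i)"
  proof
    fix x assume "x \<in> A"
    then obtain W where W: "W \<in> \<U>" "x \<in> W" using \<U>(2) by blast
    then have "W \<in> h ` {0..<card \<U>}" using bij_betw_imp_surj_on[OF h] by simp
    then obtain i where "i < card \<U>" "W = h i" by auto
    then show "x \<in> (\<Union>i. U i)" using W by (auto simp: U_def)
  qed
  moreover have "bounded (U i) \<and> diameter (U i) \<le> \<delta>" for i
    using \<U>(3,4)[OF U_in[of i]] m(1) cm \<open>0 < \<delta>\<close> by (cases "i < card \<U>") (auto simp: U_def)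
  ultimately have cover: "delta_cover \<delta> A U"
    unfolding delta_cover_def by blast
  have "(\<Sum>i. ennreal (gauge_diam s (U i))) = (\<Sum>i<card \<U>. ennreal (gauge_diam s (U i)))"
    by (intro suminf_finite) (auto simp: U_def gauge_diam_def)
  also have "\<dots> \<le> (\<Sum>i<card \<U>. ennreal ((c / 2 ^ m) powr s))"
    using \<U> U_in \<open>0 < s\<close> by (intro sum_mono ennreal_leI gauge_diam_le) auto
  also have "\<dots> = ennreal (card \<U> * (c / 2 ^ m) powr s)"
    by (simp add: ennreal_mult ennreal_of_nat_eq_real_of_nat)
  also have "\<dots> \<le> ennreal \<epsilon>"
  proof (rule ennreal_leI)
    have "card \<U> * (c / 2 ^ m) powr s \<le> K * 2 powr (t * real m) * (c / 2 ^ m) powr s"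
      using \<U> by (intro mult_right_mono) auto
    also have "\<dots> = K * c powr s * (2 powr (t - s)) ^ m"
    proof -
      have "(c / 2 ^ m) powr s = c powr s * 2 powr - (s * real m)"
        using \<open>0 \<le> c\<close> by (simp add: powr_divide powr_minus_divide powr_powr mult.commute flip: powr_realpow)
      moreover have "(2 powr (t - s)) ^ m = 2 powr (t * real m + - (s * real m))"
        by (simp add: powr_powr left_diff_distrib flip: powr_realpow)
      ultimately show ?thesis unfolding powr_add by (simp only: mult_ac)
    qed
    finally show "card \<U> * (c / 2 ^ m) powr s \<le> \<epsilon>" using m by simp
  qed
  finally show "\<exists>U. delta_cover \<delta> A U \<and> (\<Sum>i. ennreal (gauge_diam s (U i))) \<le> ennreal \<epsilon>"
    using cover by blast
qed

text \<open>
  Used to replace the sets of a cover by open ones at a small cost in diameter.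
\<close>

lemma diameter_thickening_le:
  fixes U :: "'a::metric_space set"
  assumes "bounded U" "0 \<le> \<eta>"
  shows "bounded (\<Union>u\<in>U. ball u \<eta>)" "diameter (\<Union>u\<in>U. ball u \<eta>) \<le> diameter U + 2 * \<eta>"
proof -
  have *: "dist x y \<le> diameter U + 2 * \<eta>" if "x \<in> (\<Union>u\<in>U. ball u \<eta>)" "y \<in> (\<Union>u\<in>U. ball u \<eta>)" for x y
  proof -
    from that(1) obtain u where "u \<in> U" "dist u x < \<eta>" by auto
    moreover from that(2) obtain v where "v \<in> U" "dist v y < \<eta>" by auto
    moreover have "dist u v \<le> diameter U"
      using diameter_bounded_bound assms \<open>u \<in> U\<close> \<open>v \<in> U\<close> by blast
    moreover have "dist x y \<le> dist u x + dist u v + dist v y"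
      using dist_triangle[of x y u] dist_triangle[of u y v] by (simp add: dist_commute)
    ultimately show ?thesis
      by linarith
  qed
  show "bounded (\<Union>u\<in>U. ball u \<eta>)"
    using * unfolding bounded_two_points by blast
  show "diameter (\<Union>u\<in>U. ball u \<eta>) \<le> diameter U + 2 * \<eta>"
  proof (cases "(\<Union>u\<in>U. ball u \<eta>) = {}")
    case True
    show ?thesis unfolding True using diameter_ge_0[OF assms(1)] assms(2) by simp
  next
    case False
    then have "diameter (\<Union>u\<in>U. ball u \<eta>) =
        (SUP (x, y)\<in>(\<Union>u\<in>U. ball u \<eta>) \<times> (\<Union>u\<in>U. ball u \<eta>). dist x y)"
      unfolding diameter_def by (rule if_not_P)
    also have "\<dots> \<le> diameter U + 2 * \<eta>"
    proof (rule cSUP_least)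
      show "(\<Union>u\<in>U. ball u \<eta>) \<times> (\<Union>u\<in>U. ball u \<eta>) \<noteq> {}"
        using False by blast
    next
      fix p assume "p \<in> (\<Union>u\<in>U. ball u \<eta>) \<times> (\<Union>u\<in>U. ball u \<eta>)"
      then show "(case p of (x, y) \<Rightarrow> dist x y) \<le> diameter U + 2 * \<eta>"
        unfolding mem_Times_iff case_prod_beta by (intro *) blast+
    qed
    finally show ?thesis .
  qed
qed

text \<open>
  The uniform distributions on the points \<open>p M i\<close> with \<open>i \<in> I M\<close> play the role of a measure with
  mass at most \<open>K \<delta> powr s\<close> on sets of diameter \<open>\<delta>\<close>, but no limit of them has to be formed: after a
  slight enlargement of its members a cover contains a finite subcover, and counting the points of a
  single sufficiently large level \<open>M\<close> bounds the sum of the \<open>\<delta> powr s\<close> from below by \<open>1 / K\<close>.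
  Working with \<open>diameter U \<le> \<delta>\<close> instead of equality also treats sets of diameter \<open>0\<close>.
\<close>

lemma mass_distribution_principle:
  fixes A :: "'a::metric_space set"
  assumes "compact A" "0 < s" "0 < r" "0 \<le> K"
    and fin: "\<And>M. finite (I M)" and ne: "\<And>M. I M \<noteq> {}"
    and pA: "\<And>M i. i \<in> I M \<Longrightarrow> p M i \<in> A"
    and mass: "\<And>U \<delta>. bounded U \<Longrightarrow> diameter U \<le> \<delta> \<Longrightarrow> 0 < \<delta> \<Longrightarrow> \<delta> \<le> r \<Longrightarrow>
      \<forall>\<^sub>F M in sequentially. real (card {i \<in> I M. p M i \<in> U}) \<le> K * \<delta> powr s * real (card (I M))"
  shows "hausdorff_measure s A \<noteq> 0"
proof
  assume H0: "hausdorff_measure s A = 0"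
  \<comment> \<open>the cover costs less than \<open>\<epsilon>\<close>, its enlargement another \<open>\<epsilon>\<close>, and \<open>2 K \<epsilon> < 1\<close>\<close>
  define \<epsilon> where "\<epsilon> = 1 / (2 * (K + 1))"
  have "0 < \<epsilon>" using \<open>0 \<le> K\<close> by (simp add: \<epsilon>_def)
  obtain U where U: "delta_cover (r/2) A U" "(\<Sum>i. ennreal (gauge_diam s (U i))) < ennreal \<epsilon>"
    using hausdorff_measure_eq_0D[OF H0 _ \<open>0 < \<epsilon>\<close>, of "r/2"] \<open>0 < r\<close> by auto
  have bU: "bounded (U i)" and dU: "diameter (U i) \<le> r/2" for i
    using U by (auto simp: delta_cover_def)
  have d0: "0 \<le> diameter (U i)" for i using diameter_ge_0 bU by blast
  have "\<exists>\<eta>>0. \<eta> \<le> r/4 \<and> (diameter (U i) + 2 * \<eta>) powr s < diameter (U i) powr s + \<epsilon> * (1/2) ^ Suc i" for i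
  proof -
    have "((\<lambda>\<eta>. (diameter (U i) + 2 * \<eta>) powr s) \<longlongrightarrow> (diameter (U i) + 2 * 0) powr s) (at_right 0)"
    proof (rule tendsto_powr2)
      show "((\<lambda>\<eta>. diameter (U i) + 2 * \<eta>) \<longlongrightarrow> diameter (U i) + 2 * 0) (at_right 0)"
        by (intro tendsto_intros)
      show "\<forall>\<^sub>F \<eta> in at_right 0. 0 \<le> diameter (U i) + 2 * \<eta>"
        using eventually_at_right_less[of "0::real"] by eventually_elim (use d0[of i] in simp)
    qed (use \<open>0 < s\<close> in simp_all)
    then have "\<forall>\<^sub>F \<eta> in at_right 0. (diameter (U i) + 2 * \<eta>) powr s < diameter (U i) powr s + \<epsilon> * (1/2) ^ Suc i"
      using \<open>0 < \<epsilon>\<close> by (intro order_tendstoD(2)) auto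
    moreover have "\<forall>\<^sub>F \<eta> in at_right 0. \<eta> \<le> r/4 \<and> 0 < \<eta>"
      using \<open>0 < r\<close> by (intro eventually_conj eventually_at_right_less)
        (auto simp: eventually_at_right_field intro: exI[of _ "r/4"])
    ultimately have "\<forall>\<^sub>F \<eta> in at_right 0. (\<eta> \<le> r/4 \<and> 0 < \<eta>) \<and>
        (diameter (U i) + 2 * \<eta>) powr s < diameter (U i) powr s + \<epsilon> * (1/2) ^ Suc i"
      by eventually_elim auto
    then show ?thesis
      using eventually_happens trivial_limit_at_right_real by blast
  qed
  then obtain \<eta> where \<eta>: "\<And>i. 0 < \<eta> i" "\<And>i. \<eta> i \<le> r/4"
    "\<And>i. (diameter (U i) + 2 * \<eta> i) powr s < diameter (U i) powr s + \<epsilon> * (1/2) ^ Suc i"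
    by metis
  define V where "V i = (\<Union>u\<in>U i. ball u (\<eta> i))" for i
  define \<delta> where "\<delta> i = diameter (U i) + 2 * \<eta> i" for i
  have V: "bounded (V i)" "diameter (V i) \<le> \<delta> i" "0 < \<delta> i" "\<delta> i \<le> r" for i
    using diameter_thickening_le[OF bU, of "\<eta> i" i] \<eta>(1,2)[of i] d0[of i] dU[of i]
    by (auto simp: V_def \<delta>_def)
  have "A \<subseteq> (\<Union>i. U i)" using U by (auto simp: delta_cover_def)
  also have "\<dots> \<subseteq> (\<Union>i. V i)"
    using \<eta>(1) by (force simp: V_def)
  finally have "A \<subseteq> (\<Union>i\<in>UNIV. V i)" .
  from compactE_image[OF \<open>compact A\<close> _ this]
  obtain J where J: "finite J" "A \<subseteq> (\<Union>i\<in>J. V i)"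
    by (metis V_def open_UN open_ball)
  have "\<forall>\<^sub>F M in sequentially. \<forall>j\<in>J. real (card {i \<in> I M. p M i \<in> V j}) \<le> K * \<delta> j powr s * real (card (I M))"
    using V J by (intro eventually_ball_finite ballI mass) auto
  then obtain M where M: "\<And>j. j \<in> J \<Longrightarrow> real (card {i \<in> I M. p M i \<in> V j}) \<le> K * \<delta> j powr s * real (card (I M))"
    using eventually_happens sequentially_bot by blast
  \<comment> \<open>an empty \<open>U j\<close> has gauge \<open>0\<close>, but its \<open>\<delta> j\<close> is positive\<close>
  define J' where "J' = {j \<in> J. U j \<noteq> {}}"
  have J': "finite J'" "J' \<subseteq> J" using J by (auto simp: J'_def)
  have "I M = (\<Union>j\<in>J'. {i \<in> I M. p M i \<in> V j})"
    using pA J by (fastforce simp: J'_def V_def)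
  then have "real (card (I M)) \<le> (\<Sum>j\<in>J'. real (card {i \<in> I M. p M i \<in> V j}))"
    using card_UN_le[OF J'(1), of "\<lambda>j. {i \<in> I M. p M i \<in> V j}"] by (simp flip: of_nat_sum)
  also have "\<dots> \<le> (\<Sum>j\<in>J'. K * \<delta> j powr s * real (card (I M)))"
    using M J' by (intro sum_mono) auto
  also have "\<dots> = real (card (I M)) * (K * (\<Sum>j\<in>J'. \<delta> j powr s))"
    by (simp add: sum_distrib_left sum_distrib_right mult_ac)
  finally have "1 \<le> K * (\<Sum>j\<in>J'. \<delta> j powr s)"
    using fin[of M] ne[of M] by (simp add: card_gt_0_iff)
  also have "\<dots> \<le> K * (\<epsilon> + \<epsilon>)"
  proof (intro mult_left_mono \<open>0 \<le> K\<close>)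
    have "(\<Sum>j\<in>J'. \<delta> j powr s) \<le> (\<Sum>j\<in>J'. gauge_diam s (U j) + \<epsilon> * (1/2) ^ Suc j)"
      using \<eta>(3) \<open>0 < s\<close> by (intro sum_mono) (auto simp: J'_def gauge_diam_def \<delta>_def intro: less_imp_le)
    also have "\<dots> = (\<Sum>j\<in>J'. gauge_diam s (U j)) + \<epsilon> * (\<Sum>j\<in>J'. (1/2) ^ Suc j)"
      by (simp add: sum.distrib sum_distrib_left)
    also have "\<dots> \<le> \<epsilon> + \<epsilon> * 1"
    proof (intro add_mono mult_left_mono)
      have "(\<Sum>j\<in>J'. (1/2::real) ^ Suc j) \<le> (\<Sum>j. (1/2::real) ^ Suc j)"
        using power_half_series J' by (intro sum_le_suminf) (auto simp: sums_iff)
      also have "\<dots> = 1" using power_half_series by (simp add: sums_iff)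
      finally show "(\<Sum>j\<in>J'. (1/2::real) ^ Suc j) \<le> 1" .
      have g0: "0 \<le> gauge_diam s (U j)" for j by (simp add: gauge_diam_def)
      have "ennreal (\<Sum>j\<in>J'. gauge_diam s (U j)) = (\<Sum>j\<in>J'. ennreal (gauge_diam s (U j)))"
        using g0 by (simp add: sum_ennreal)
      also have "\<dots> \<le> (\<Sum>i. ennreal (gauge_diam s (U i)))"
        using J' by (intro sum_le_suminf) auto
      also have "\<dots> < ennreal \<epsilon>" by (rule U)
      finally show "(\<Sum>j\<in>J'. gauge_diam s (U j)) \<le> \<epsilon>"
        using \<open>0 < \<epsilon>\<close> by (simp add: ennreal_less_iff sum_nonneg g0)
    qed (use \<open>0 < \<epsilon>\<close> in auto)
    finally show "(\<Sum>j\<in>J'. \<delta> j powr s) \<le> \<epsilon> + \<epsilon>" by simp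
  qed
  also have "\<dots> < 1" using \<open>0 \<le> K\<close> by (simp add: \<epsilon>_def field_simps)
  finally show False by simp
qed

lemma hausdorff_measure_0_nonzero:
  assumes "A \<noteq> {}"
  shows "hausdorff_measure 0 A \<noteq> 0"
proof
  assume "hausdorff_measure 0 A = 0"
  then obtain U where U: "delta_cover 1 A U" "(\<Sum>i. ennreal (gauge_diam 0 (U i))) < ennreal 1"
    using hausdorff_measure_eq_0D[of 0 A 1 1] by auto
  then obtain i where "U i \<noteq> {}" using assms by (force simp: delta_cover_def)
  then have "ennreal 1 = (\<Sum>j\<in>{i}. ennreal (gauge_diam 0 (U j)))" by (simp add: gauge_diam_def)
  also have "\<dots> \<le> (\<Sum>i. ennreal (gauge_diam 0 (U i)))" by (intro sum_le_suminf) auto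
  finally show False using U by simp
qed

text \<open>
  Exponent \<open>0\<close> is settled by the counting measure, which does not vanish on a nonempty set.
\<close>

lemma hausdorff_dim_eqI:
  assumes "A \<noteq> {}" "0 \<le> D"
    and "\<And>s. D < s \<Longrightarrow> hausdorff_measure s A = 0"
    and "\<And>s. 0 < s \<Longrightarrow> s < D \<Longrightarrow> hausdorff_measure s A \<noteq> 0"
  shows "hausdorff_dim A = ereal D"
proof (rule antisym)
  show "hausdorff_dim A \<le> ereal D"
  proof (rule ereal_le_epsilon2)
    fix e :: real assume "0 < e"
    then have "hausdorff_dim A \<le> ereal (D + e)"
      unfolding hausdorff_dim_def using assms by (intro INF_lower) auto
    then show "hausdorff_dim A \<le> ereal D + ereal e" by simp
  qed
  show "ereal D \<le> hausdorff_dim A"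
    unfolding hausdorff_dim_def
  proof (rule INF_greatest)
    fix s assume "s \<in> {s. 0 \<le> s \<and> hausdorff_measure s A = 0}"
    then show "ereal D \<le> ereal s"
      using assms(4)[of s] hausdorff_measure_0_nonzero[OF assms(1)] by force
  qed
qed

section \<open>Sets of points with admissible binary digits\<close>

definition binval :: "(nat \<Rightarrow> bool) \<Rightarrow> real" where
  "binval e = (\<Sum>l. of_bool (e l) / 2 ^ Suc l)"

definition bintrunc :: "nat \<Rightarrow> (nat \<Rightarrow> bool) \<Rightarrow> real" where
  "bintrunc m e = (\<Sum>l<m. of_bool (e l) / 2 ^ Suc l)"

definition shift :: "nat \<Rightarrow> (nat \<Rightarrow> 'a) \<Rightarrow> nat \<Rightarrow> 'a" where
  "shift n w = (\<lambda>l. w (n + l))"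

definition ones_below :: "(nat \<Rightarrow> bool) \<Rightarrow> nat \<Rightarrow> nat" where
  "ones_below w m = card {l. l < m \<and> w l}"

text \<open>
  The \<open>d\<close>-fold product of the set of reals in \<open>[0, 1]\<close> with a binary expansion supported on \<open>w\<close>.
  All coordinates use the same \<open>w\<close>, but choose their digits independently.
\<close>

definition digit_set :: "(nat \<Rightarrow> bool) \<Rightarrow> (real ^ 'n) set" where
  "digit_set w = {\<chi> i. binval (e i) | e. \<forall>i l. e i l \<longrightarrow> w l}"

lemma digit_setI: "(\<And>i l. e i l \<Longrightarrow> w l) \<Longrightarrow> (\<chi> i. binval (e i)) \<in> digit_set w"
  unfolding digit_set_def by blast

lemma digit_setD: "x \<in> digit_set w \<Longrightarrow> \<exists>e. (\<forall>i l. e i l \<longrightarrow> w l) \<and> x = (\<chi> i. binval (e i))"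
  unfolding digit_set_def by blast

lemma digit_setE:
  assumes "x \<in> digit_set w"
  obtains e where "\<And>i l. e i l \<Longrightarrow> w l" "x = (\<chi> i. binval (e i))"
  using assms unfolding digit_set_def by blast

lemma power_half_sums: "(\<lambda>l. 1 / 2 ^ Suc l :: real) sums 1"
  using power_half_series by (simp add: power_one_over)

lemma summable_binval: "summable (\<lambda>l. of_bool (e l) / 2 ^ Suc l :: real)"
  using power_half_sums
  by (intro summable_comparison_test[OF _ sums_summable[OF power_half_sums]]) auto

lemma binval_nonneg: "0 \<le> binval e"
  unfolding binval_def by (intro suminf_nonneg summable_binval) auto

lemma binval_le_1: "binval e \<le> 1"
proof -
  have "binval e \<le> (\<Sum>l. 1 / 2 ^ Suc l)"
    unfolding binval_def using power_half_sums
    by (intro suminf_le summable_binval) (auto simp: sums_iff)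
  then show ?thesis using power_half_sums by (simp add: sums_iff)
qed

lemma binval_split: "binval e = bintrunc m e + binval (shift m e) / 2 ^ m"
proof -
  have "binval e = (\<Sum>l. of_bool (e (l + m)) / 2 ^ Suc (l + m)) + bintrunc m e"
    unfolding binval_def bintrunc_def
    by (rule suminf_split_initial_segment[OF summable_binval])
  also have "(\<Sum>l. of_bool (e (l + m)) / 2 ^ Suc (l + m)) = (\<Sum>l. of_bool (shift m e l) / 2 ^ Suc l / 2 ^ m :: real)"
    by (simp add: shift_def power_add mult_ac add.commute)
  also have "\<dots> = binval (shift m e) / 2 ^ m"
    unfolding binval_def by (rule suminf_divide[OF summable_binval])
  finally show ?thesis by simp
qed

lemma bintrunc_le_binval: "bintrunc m e \<le> binval e"
  using binval_split[of e m] binval_nonneg[of "shift m e"] by simp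

lemma binval_le_bintrunc: "binval e \<le> bintrunc m e + 1 / 2 ^ m"
  using binval_split[of e m] binval_le_1[of "shift m e"] by (simp add: divide_right_mono)

lemma bintrunc_cong: "(\<And>l. l < m \<Longrightarrow> e l = e' l) \<Longrightarrow> bintrunc m e = bintrunc m e'"
  unfolding bintrunc_def by (intro sum.cong) auto

lemma bintrunc_nonneg: "0 \<le> bintrunc m e"
  unfolding bintrunc_def by (intro sum_nonneg) auto

lemma binval_truncated: "binval (\<lambda>l. l < m \<and> e l) = bintrunc m e"
proof -
  have "binval (shift m (\<lambda>l. l < m \<and> e l)) = 0"
    by (simp add: binval_def shift_def)
  then show ?thesis
    using binval_split[of "\<lambda>l. l < m \<and> e l" m] bintrunc_cong[of m "\<lambda>l. l < m \<and> e l" e] by simp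
qed

lemma binval_append: "binval (\<lambda>l. if l < m then e l else e' (l - m)) = bintrunc m e + binval e' / 2 ^ m"
proof -
  have "shift m (\<lambda>l. if l < m then e l else e' (l - m)) = e'"
    by (simp add: shift_def fun_eq_iff)
  then show ?thesis
    using binval_split[of "\<lambda>l. if l < m then e l else e' (l - m)" m]
      bintrunc_cong[of m "\<lambda>l. if l < m then e l else e' (l - m)" e] by simp
qed

text \<open>
  A truncated expansion is an integer multiple of \<open>2\<^sup>-\<^sup>n\<close>. The library's encoding of finite sets as
  naturals, read from the least significant place, shows in addition that the
  digits are determined by the value.
\<close>

lemma bintrunc_set_encode:
  "2 ^ n * bintrunc n (\<lambda>l. l \<in> h) = real (set_encode ((\<lambda>l. n - Suc l) ` (h \<inter> {..<n})))"
proof -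
  have inj: "inj_on (\<lambda>l. n - Suc l) (h \<inter> {..<n})"
    by (auto simp: inj_on_def)
  have "2 ^ n * bintrunc n (\<lambda>l. l \<in> h) = (\<Sum>l<n. if l \<in> h then 2 ^ (n - Suc l) else 0)"
    unfolding bintrunc_def sum_distrib_left
    by (intro sum.cong) (auto simp: power_diff)
  also have "\<dots> = (\<Sum>l\<in>h \<inter> {..<n}. 2 ^ (n - Suc l))"
    by (simp add: sum.If_cases Int_commute)
  also have "\<dots> = real (set_encode ((\<lambda>l. n - Suc l) ` (h \<inter> {..<n})))"
    unfolding set_encode_def by (simp add: sum.reindex[OF inj])
  finally show ?thesis .
qed

lemma card_nats_in_interval_le:
  fixes y :: real
  assumes "\<And>k. k \<in> K \<Longrightarrow> y \<le> real k" "\<And>k. k \<in> K \<Longrightarrow> real k \<le> y + real b"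
  shows "card K \<le> b + 1" "finite K"
proof -
  have sub: "int ` K \<subseteq> {\<lceil>y\<rceil>..\<lceil>y\<rceil> + int b}"
  proof
    fix j assume "j \<in> int ` K"
    then obtain k where "k \<in> K" "j = int k" by blast
    then show "j \<in> {\<lceil>y\<rceil>..\<lceil>y\<rceil> + int b}"
      using assms[of k] by (simp add: ceiling_le_iff) linarith
  qed
  have "card (int ` K) \<le> b + 1"
    using card_mono[OF _ sub] by simp
  then show "card K \<le> b + 1" by (simp add: card_image)
  show "finite K" using finite_subset[OF sub] by (simp add: finite_image_iff)
qed

lemma ones_below_add:
  "ones_below w (n + m) = ones_below w n + ones_below (shift n w) m"
proof -
  have "{l. l < n + m \<and> w l} = {l. l < n \<and> w l} \<union> (+) n ` {l. l < m \<and> shift n w l}"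
  proof (intro set_eqI iffI)
    fix l assume "l \<in> {l. l < n + m \<and> w l}"
    then show "l \<in> {l. l < n \<and> w l} \<union> (+) n ` {l. l < m \<and> shift n w l}"
      by (cases "l < n") (auto simp: shift_def image_iff intro!: exI[of _ "l - n"])
  qed (auto simp: shift_def)
  moreover have "{l. l < n \<and> w l} \<inter> (+) n ` {l. l < m \<and> shift n w l} = {}" by auto
  ultimately show ?thesis
    by (simp add: ones_below_def card_Un_disjoint card_image)
qed

lemma ones_below_mono: "n \<le> m \<Longrightarrow> ones_below w n \<le> ones_below w m"
  unfolding ones_below_def by (intro card_mono) auto

lemma ones_below_cong: "(\<And>l. l < m \<Longrightarrow> w l = w' l) \<Longrightarrow> ones_below w m = ones_below w' m"
  unfolding ones_below_def by (intro arg_cong[where f=card]) auto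

text \<open>
  A set of codes is split into its first \<open>n\<close> places and the rest. The head lies within \<open>2\<^sup>-\<^sup>n\<close> below
  the value, and all values are within \<open>2\<^sup>-\<^sup>n\<close> of one of them, so that there are at most four
  heads; the rest is an arbitrary set of admissible places from \<open>n\<close> on.
\<close>

lemma card_codes_near:
  assumes "n \<le> M" and J: "\<And>x y. x \<in> J \<Longrightarrow> y \<in> J \<Longrightarrow> \<bar>x - y\<bar> \<le> 1 / 2 ^ n"
  shows "card {S \<in> Pow {l. l < M \<and> w l}. binval (\<lambda>l. l \<in> S) \<in> J} \<le> 4 * 2 ^ (ones_below w M - ones_below w n)"
proof (cases "J = {}")
  case False
  then obtain x0 where x0: "x0 \<in> J" by blast
  define H where "H = {h \<in> Pow {..<n}. 2 ^ n * x0 - 2 \<le> 2 ^ n * bintrunc n (\<lambda>l. l \<in> h) \<and>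
      2 ^ n * bintrunc n (\<lambda>l. l \<in> h) \<le> 2 ^ n * x0 + 1}"
  define T where "T = {l. n \<le> l \<and> l < M \<and> w l}"
  define enc where "enc h = set_encode ((\<lambda>l. n - Suc l) ` h)" for h
  have fin: "finite H" "finite T" unfolding H_def T_def by (rule finite_subset[of _ "Pow {..<n}"], auto)
  have enc: "2 ^ n * bintrunc n (\<lambda>l. l \<in> h) = real (enc h)" if "h \<subseteq> {..<n}" for h
    using that bintrunc_set_encode[of n h] by (simp add: enc_def Int_absorb2)
  have inj: "inj_on enc (Pow {..<n})"
  proof (rule inj_onI)
    fix g h assume gh: "g \<in> Pow {..<n}" "h \<in> Pow {..<n}" "enc g = enc h"
    then have "finite g" "finite h" using finite_subset by auto
    then have "(\<lambda>l. n - Suc l) ` g = (\<lambda>l. n - Suc l) ` h"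
      using gh set_encode_eq[of "(\<lambda>l. n - Suc l) ` g" "(\<lambda>l. n - Suc l) ` h"] by (simp add: enc_def)
    moreover have "inj_on (\<lambda>l. n - Suc l) {..<n}" by (auto simp: inj_on_def)
    ultimately show "g = h" using gh inj_on_image_eq_iff by blast
  qed
  have "card (enc ` H) \<le> 3 + 1"
    by (rule card_nats_in_interval_le[where y = "2 ^ n * x0 - 2"]) (auto simp: H_def enc)
  then have cH: "card H \<le> 4"
    using inj by (subst (asm) card_image) (auto simp: H_def intro: inj_on_subset)
  have cT: "card T = ones_below w M - ones_below w n"
  proof -
    have "{l. l < M \<and> w l} = {l. l < n \<and> w l} \<union> T" "{l. l < n \<and> w l} \<inter> T = {}"
      using \<open>n \<le> M\<close> by (auto simp: T_def)
    then have "ones_below w M = ones_below w n + card T"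
      using fin by (simp add: ones_below_def card_Un_disjoint)
    then show ?thesis by simp
  qed
  let ?A = "{S \<in> Pow {l. l < M \<and> w l}. binval (\<lambda>l. l \<in> S) \<in> J}"
  have "card ?A \<le> card (H \<times> Pow T)"
  proof (rule card_inj_on_le[where f = "\<lambda>S. (S \<inter> {..<n}, S \<inter> {n..})"])
    show "inj_on (\<lambda>S. (S \<inter> {..<n}, S \<inter> {n..})) ?A"
    proof (rule inj_onI)
      fix S S' assume "(S \<inter> {..<n}, S \<inter> {n..}) = (S' \<inter> {..<n}, S' \<inter> {n..})"
      moreover have "S = S \<inter> {..<n} \<union> S \<inter> {n..}" "S' = S' \<inter> {..<n} \<union> S' \<inter> {n..}" by auto
      ultimately show "S = S'" by auto
    qed
    show "(\<lambda>S. (S \<inter> {..<n}, S \<inter> {n..})) ` ?A \<subseteq> H \<times> Pow T"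
    proof
      fix p assume "p \<in> (\<lambda>S. (S \<inter> {..<n}, S \<inter> {n..})) ` ?A"
      then obtain S where S: "S \<subseteq> {l. l < M \<and> w l}" "binval (\<lambda>l. l \<in> S) \<in> J"
        and p: "p = (S \<inter> {..<n}, S \<inter> {n..})" by auto
      have tr: "bintrunc n (\<lambda>l. l \<in> S \<inter> {..<n}) = bintrunc n (\<lambda>l. l \<in> S)"
        by (rule bintrunc_cong) auto
      have "\<bar>binval (\<lambda>l. l \<in> S) - x0\<bar> \<le> 1 / 2 ^ n" using J S x0 by blast
      then have "bintrunc n (\<lambda>l. l \<in> S) \<le> x0 + 1 / 2 ^ n" "x0 - 2 / 2 ^ n \<le> bintrunc n (\<lambda>l. l \<in> S)"
        using bintrunc_le_binval[of n "\<lambda>l. l \<in> S"] binval_le_bintrunc[of "\<lambda>l. l \<in> S" n] by (auto simp: abs_le_iff)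
      then have "S \<inter> {..<n} \<in> H" unfolding H_def mem_Collect_eq tr by (auto simp: field_simps)
      moreover have "S \<inter> {n..} \<in> Pow T" using S by (auto simp: T_def)
      ultimately show "p \<in> H \<times> Pow T" by (simp add: p)
    qed
  qed (use fin in auto)
  also have "\<dots> \<le> 4 * 2 ^ (ones_below w M - ones_below w n)"
    using cH fin by (simp add: card_cartesian_product card_Pow cT)
  finally show ?thesis .
qed simp

lemma card_codes_near_cube:
  fixes U :: "(real ^ 'n::finite) set"
  assumes "n \<le> M" and U: "\<And>x y. x \<in> U \<Longrightarrow> y \<in> U \<Longrightarrow> dist x y \<le> 1 / 2 ^ n"
  shows "card {S \<in> UNIV \<rightarrow>\<^sub>E Pow {l. l < M \<and> w l}. (\<chi> i. binval (\<lambda>l. l \<in> S i)) \<in> U}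
    \<le> (4 * 2 ^ (ones_below w M - ones_below w n)) ^ CARD('n)"
proof -
  let ?B = "\<lambda>i. {S \<in> Pow {l. l < M \<and> w l}. binval (\<lambda>l. l \<in> S) \<in> (\<lambda>x. x $ i) ` U}"
  have fin: "finite (?B i)" for i by (rule finite_subset[of _ "Pow {..<M}"]) auto
  have "card {S \<in> UNIV \<rightarrow>\<^sub>E Pow {l. l < M \<and> w l}. (\<chi> i. binval (\<lambda>l. l \<in> S i)) \<in> U} \<le> card (PiE UNIV ?B)"
  proof (rule card_mono)
    show "finite (PiE UNIV ?B)" by (intro finite_PiE fin) auto
    show "{S \<in> UNIV \<rightarrow>\<^sub>E Pow {l. l < M \<and> w l}. (\<chi> i. binval (\<lambda>l. l \<in> S i)) \<in> U} \<subseteq> PiE UNIV ?B"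
      by (force simp: PiE_def Pi_def image_iff)
  qed
  also have "\<dots> = (\<Prod>i\<in>UNIV. card (?B i))" by (rule card_PiE) simp
  also have "\<dots> \<le> (\<Prod>i\<in>(UNIV::'n set). 4 * 2 ^ (ones_below w M - ones_below w n))"
  proof (intro prod_mono conjI card_codes_near \<open>n \<le> M\<close>)
    fix i x y assume "x \<in> (\<lambda>x. x $ i) ` U" "y \<in> (\<lambda>x. x $ i) ` U"
    then obtain x' y' where "x' \<in> U" "y' \<in> U" "x = x' $ i" "y = y' $ i" by blast
    then show "\<bar>x - y\<bar> \<le> 1 / 2 ^ n"
      using U[of x' y'] dist_vec_nth_le[of x' i y'] by (simp add: dist_real_def)
  qed auto
  finally show ?thesis by simp
qed

text \<open>
  Sequential compactness of the Cantor space, by diagonalisation.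
\<close>

lemma bool_sequences_subseq:
  fixes f :: "nat \<Rightarrow> 'i::countable \<Rightarrow> bool"
  obtains r g where "strict_mono (r :: nat \<Rightarrow> nat)" "\<And>i. \<forall>\<^sub>F k in sequentially. f (r k) i = g i"
proof -
  define P where "P n s = (\<exists>b. \<forall>k. f (s k) (from_nat n) = b)" for n :: nat and s :: "nat \<Rightarrow> nat"
  interpret subseqs P
  proof
    fix n s assume "strict_mono (s :: nat \<Rightarrow> nat)"
    have "\<exists>b. infinite {k. f (s k) (from_nat n) = b}"
    proof (rule ccontr)
      assume "\<not> ?thesis"
      then have "finite ({k. f (s k) (from_nat n) = True} \<union> {k. f (s k) (from_nat n) = False})" by blast
      moreover have "{k. f (s k) (from_nat n) = True} \<union> {k. f (s k) (from_nat n) = False} = UNIV" by auto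
      ultimately show False using infinite_UNIV_nat by metis
    qed
    then obtain b where "infinite {k. f (s k) (from_nat n) = b}" by blast
    then obtain r where "strict_mono (r :: nat \<Rightarrow> nat)" "\<And>k. r k \<in> {k. f (s k) (from_nat n) = b}"
      using infinite_enumerate by blast
    then show "\<exists>r'. strict_mono r' \<and> P n (s \<circ> r')" by (auto simp: P_def)
  qed
  have "P n (diagseq \<circ> (+) (Suc n))" for n
    by (rule diagseq_holds) (auto simp: P_def)
  then have "\<exists>b. \<forall>k. f (diagseq (Suc n + k)) (from_nat n) = b" for n by (simp add: P_def)
  then obtain b where b: "\<And>n k. f (diagseq (Suc n + k)) (from_nat n) = b n" by metis
  show ?thesis
  proof (rule that)
    show "strict_mono diagseq" by (rule subseq_diagseq)
    fix i :: 'i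
    have "f (diagseq k) i = b (to_nat i)" if "Suc (to_nat i) \<le> k" for k
      using b[of "to_nat i" "k - Suc (to_nat i)"] that by simp
    then show "\<forall>\<^sub>F k in sequentially. f (diagseq k) i = b (to_nat i)"
      unfolding eventually_sequentially by blast
  qed
qed

lemma eventually_agree_below:
  assumes "\<And>l. \<forall>\<^sub>F k in F. f k l = g l"
  shows "\<forall>\<^sub>F k in F. \<forall>l<(m::nat). f k l = g l"
proof -
  have "\<forall>\<^sub>F k in F. \<forall>l\<in>{..<m}. f k l = g l"
    using assms by (intro eventually_ball_finite) auto
  then show ?thesis by eventually_elim simp
qed

lemma binval_dist_le:
  assumes "\<And>l. l < m \<Longrightarrow> e l = e' l"
  shows "\<bar>binval e - binval e'\<bar> \<le> 1 / 2 ^ m"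
proof -
  have "bintrunc m e = bintrunc m e'" by (rule bintrunc_cong) (rule assms)
  then show ?thesis
    using bintrunc_le_binval[of m e] binval_le_bintrunc[of e m]
      bintrunc_le_binval[of m e'] binval_le_bintrunc[of e' m] by linarith
qed

lemma tendsto_binval:
  assumes "\<And>l. \<forall>\<^sub>F k in F. f k l = g l"
  shows "((\<lambda>k. binval (f k)) \<longlongrightarrow> binval g) F"
proof (rule tendstoI)
  fix e :: real assume "0 < e"
  then obtain m where m: "(1/2) ^ m < e" using real_arch_pow_inv[of e "1/2"] by auto
  show "\<forall>\<^sub>F k in F. dist (binval (f k)) (binval g) < e"
  proof (rule eventually_mono)
    show "\<forall>\<^sub>F k in F. \<forall>l<m. f k l = g l" by (rule eventually_agree_below) (rule assms)
    fix k assume "\<forall>l<m. f k l = g l"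
    then have "\<bar>binval (f k) - binval g\<bar> \<le> 1 / 2 ^ m" by (intro binval_dist_le) auto
    then show "dist (binval (f k)) (binval g) < e" using m by (simp add: dist_real_def power_one_over)
  qed
qed

lemma compact_digit_set: "compact (digit_set w :: (real ^ 'n::finite) set)"
  unfolding compact_eq_seq_compact_metric seq_compact_def
proof (intro allI impI)
  fix x :: "nat \<Rightarrow> real ^ 'n" assume "\<forall>k. x k \<in> digit_set w"
  then have "\<forall>k. \<exists>e. (\<forall>i l. e i l \<longrightarrow> w l) \<and> x k = (\<chi> i. binval (e i))"
    unfolding digit_set_def by blast
  then obtain e where e: "\<And>k i l. e k i l \<Longrightarrow> w l" "\<And>k. x k = (\<chi> i. binval (e k i))" by metis
  obtain r g where r: "strict_mono (r :: nat \<Rightarrow> nat)"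
    and g: "\<And>p. \<forall>\<^sub>F k in sequentially. (case p of (i, l) \<Rightarrow> e (r k) i l) = g p"
    using bool_sequences_subseq[of "\<lambda>k (i, l). e k i l"] by blast
  have g': "\<forall>\<^sub>F k in sequentially. e (r k) i l = g (i, l)" for i l using g[of "(i, l)"] by simp
  have "w l" if "g (i, l)" for i l
  proof -
    obtain k where "e (r k) i l = g (i, l)"
      using eventually_happens[OF g'[of i l]] by auto
    then show ?thesis using that e by auto
  qed
  then have "(\<chi> i. binval (\<lambda>l. g (i, l))) \<in> digit_set w"
    by (rule digit_setI)
  moreover have "(x \<circ> r) \<longlonglongrightarrow> (\<chi> i. binval (\<lambda>l. g (i, l)))"
    by (rule vec_tendstoI) (auto simp: e(2) intro!: tendsto_binval g')
  ultimately show "\<exists>l\<in>digit_set w. \<exists>r. strict_mono r \<and> (x \<circ> r) \<longlonglongrightarrow> l"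
    using r by blast
qed

lemma digit_set_subset: "digit_set w \<subseteq> (unit_cube :: (real ^ 'n::finite) set)"
  by (auto elim!: digit_setE simp: mem_box_cart binval_nonneg binval_le_1)

lemma dyadic_scale:
  fixes x :: real
  assumes "1 \<le> x"
  obtains n where "2 ^ n \<le> x" "x < 2 ^ Suc n"
proof -
  define n where "n = (LEAST n. x < 2 ^ n)"
  have n: "x < 2 ^ n" unfolding n_def using real_arch_pow[of 2 x] by (auto intro: LeastI_ex)
  then obtain k where k: "n = Suc k" using assms by (cases n) auto
  then have "\<not> x < 2 ^ k" unfolding n_def using not_less_Least[of k "\<lambda>n. x < 2 ^ n"] by auto
  then show ?thesis using that[of k] n k by simp
qed

text \<open>
  The points of level \<open>M\<close> are the finite expansions of length \<open>M\<close>. A set of diameter about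
  \<open>c 2\<^sup>-\<^sup>n\<close> contains at most a constant times the fraction \<open>2 powr - (d * ones_below w n)\<close> of
  them, which is at most a constant times \<open>2 powr - (s * n)\<close> by the assumption on \<open>w\<close>.
\<close>

lemma hausdorff_measure_pos_of_copy:
  fixes A :: "(real ^ 'n::finite) set"
  assumes "compact A" "0 < c" and copy: "(\<lambda>x. v + c *\<^sub>R x) ` digit_set w \<subseteq> A" and "0 < s"
    and dens: "\<forall>\<^sub>F n in sequentially. s * real n \<le> CARD('n) * real (ones_below w n)"
  shows "hausdorff_measure s A \<noteq> 0"
proof -
  let ?d = "CARD('n)"
  obtain n0 where n0: "\<And>n. n0 \<le> n \<Longrightarrow> s * real n \<le> ?d * real (ones_below w n)"
    using dens by (auto simp: eventually_sequentially)
  have K1: "2 powr (s * n) \<le> 2 powr (s * n0) * 2 powr (?d * real (ones_below w n))" for n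
  proof (cases "n0 \<le> n")
    case True
    have "2 powr (s * n) \<le> 2 powr (s * n0 + ?d * real (ones_below w n))"
      using n0[OF True] \<open>0 < s\<close> by (intro powr_mono) (auto simp: add_increasing)
    then show ?thesis by (simp add: powr_add)
  next
    case False
    have "2 powr (s * n) \<le> 2 powr (s * n0 + ?d * real (ones_below w n))"
      using False \<open>0 < s\<close> by (intro powr_mono) (auto intro!: add_increasing2 mult_left_mono)
    then show ?thesis by (simp add: powr_add)
  qed
  define I where "I M = (UNIV :: 'n set) \<rightarrow>\<^sub>E Pow {l. l < M \<and> w l}" for M
  define pt where "pt S = (\<chi> i. binval (\<lambda>l. l \<in> S i) :: real ^ 'n)" for S :: "'n \<Rightarrow> nat set"
  define K where "K = 4 ^ ?d * 2 powr (s * n0) * (2 / c) powr s"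
  have cI: "card (I M) = (2 ^ ones_below w M) ^ ?d" for M
    by (simp add: I_def card_PiE card_Pow ones_below_def)
  show ?thesis
  proof (rule mass_distribution_principle[where I = I and p = "\<lambda>M S. v + c *\<^sub>R pt S" and r = c and K = K])
    show "finite (I M)" for M unfolding I_def by (intro finite_PiE) auto
    show "I M \<noteq> {}" for M unfolding I_def by (simp add: PiE_eq_empty_iff) blast
    show "0 \<le> K" by (simp add: K_def)
    show "v + c *\<^sub>R pt S \<in> A" if "S \<in> I M" for M S
    proof -
      have "pt S \<in> digit_set w"
        unfolding pt_def using that by (intro digit_setI) (auto simp: I_def PiE_def Pi_def)
      then show ?thesis using copy by blast
    qed
    fix U :: "(real ^ 'n) set" and \<delta> :: real
    assume U: "bounded U" "diameter U \<le> \<delta>" "0 < \<delta>" "\<delta> \<le> c"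
    obtain n where n: "2 ^ n \<le> c / \<delta>" "c / \<delta> < 2 ^ Suc n"
      using U dyadic_scale[of "c / \<delta>"] by auto
    let ?U = "{x. v + c *\<^sub>R x \<in> U}"
    have near: "dist x y \<le> 1 / 2 ^ n" if "x \<in> ?U" "y \<in> ?U" for x y
    proof -
      have "c * dist x y = dist (v + c *\<^sub>R x) (v + c *\<^sub>R y)"
        using \<open>0 < c\<close> by (simp add: dist_norm flip: scaleR_diff_right)
      also have "\<dots> \<le> \<delta>"
        using that diameter_bounded_bound[OF U(1)] U(2) by fastforce
      finally have "dist x y \<le> \<delta> / c" using \<open>0 < c\<close> by (simp add: field_simps)
      also have "\<dots> \<le> 1 / 2 ^ n" using n(1) \<open>0 < c\<close> \<open>0 < \<delta>\<close> by (simp add: field_simps)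
      finally show ?thesis .
    qed
    show "\<forall>\<^sub>F M in sequentially. real (card {S \<in> I M. v + c *\<^sub>R pt S \<in> U}) \<le> K * \<delta> powr s * real (card (I M))"
      using eventually_ge_at_top[of n]
    proof eventually_elim
      case (elim M)
      have "card {S \<in> I M. pt S \<in> ?U} \<le> (4 * 2 ^ (ones_below w M - ones_below w n)) ^ ?d"
        unfolding I_def pt_def by (rule card_codes_near_cube[OF elim]) (rule near)
      then have "real (card {S \<in> I M. v + c *\<^sub>R pt S \<in> U}) \<le> real ((4 * 2 ^ (ones_below w M - ones_below w n)) ^ ?d)"
        by (simp only: mem_Collect_eq of_nat_le_iff)
      also have "\<dots> = 4 ^ ?d * real (card (I M)) * (1 / 2 powr (?d * real (ones_below w n)))"
      proof -
        have "real ((4 * 2 ^ (ones_below w M - ones_below w n)) ^ ?d) = (4 * 2 ^ (ones_below w M - ones_below w n)) ^ ?d"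
          by (simp only: of_nat_power of_nat_mult of_nat_numeral)
        also have "\<dots> = 4 ^ ?d * (2 ^ ones_below w M) ^ ?d * (1 / (2 ^ ones_below w n) ^ ?d)"
          using ones_below_mono[OF elim, of w] by (simp add: power_diff power_mult_distrib power_divide)
        also have "(2 ^ ones_below w n) ^ ?d = 2 powr (?d * real (ones_below w n))"
          by (simp add: powr_powr mult.commute flip: powr_realpow)
        finally show ?thesis by (simp add: cI)
      qed
      also have "\<dots> \<le> 4 ^ ?d * real (card (I M)) * (2 powr (s * n0) * ((2 / c) powr s * \<delta> powr s))"
      proof (intro mult_left_mono)
        have "1 / 2 powr (?d * real (ones_below w n)) \<le> 2 powr (s * n0) * (1 / 2 powr (s * n))"
          using K1[of n] by (simp add: field_simps)
        also have "1 / 2 powr (s * n) = (1 / 2 ^ n) powr s"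
          by (simp add: powr_divide powr_powr mult.commute flip: powr_realpow)
        also have "(1 / 2 ^ n) powr s \<le> (2 / c * \<delta>) powr s"
          using n(2) \<open>0 < c\<close> \<open>0 < \<delta>\<close> \<open>0 < s\<close> by (intro powr_mono2) (auto simp: field_simps)
        also have "(2 / c * \<delta>) powr s = (2 / c) powr s * \<delta> powr s"
          by (rule powr_mult)
        finally show "1 / 2 powr (?d * real (ones_below w n)) \<le> 2 powr (s * n0) * ((2 / c) powr s * \<delta> powr s)"
          by simp
      qed auto
      finally show ?case by (simp add: K_def mult_ac)
    qed
  qed (use assms in auto)
qed

section \<open>Prescribing the lower densities of all limits of shifts\<close>

text \<open>
  The equation \<open>liminf N u / u = s\<close> without division and extended reals.
\<close>

definition lower_density :: "(nat \<Rightarrow> real) \<Rightarrow> real \<Rightarrow> bool" where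
  "lower_density N s \<longleftrightarrow>
     (\<forall>x<s. \<forall>\<^sub>F u in sequentially. x * real u \<le> N u) \<and>
     (\<forall>x>s. \<exists>\<^sub>F u in sequentially. N u \<le> x * real u)"

lemma eventually_const_le_mult:
  assumes "0 < (x::real)"
  shows "\<forall>\<^sub>F u in sequentially. C \<le> x * real u"
proof -
  have "filterlim (\<lambda>u. x * real u) at_top sequentially"
    using assms by (intro filterlim_tendsto_pos_mult_at_top[OF tendsto_const] filterlim_real_sequentially)
  then show ?thesis by (simp add: filterlim_at_top)
qed

text \<open>
  The offset \<open>c\<close> allows a finite initial part of the sequence to be discarded.
\<close>

lemma lower_density_of_bounded:
  assumes "\<And>u. \<bar>N (c + u) - s * real u\<bar> \<le> C"
  shows "lower_density N s"
proof -
  have *: "\<bar>N u - s * real u\<bar> \<le> C + \<bar>s * real c\<bar>" if "c \<le> u" for u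
  proof -
    have "N u - s * real u = (N (c + (u - c)) - s * real (u - c)) - s * real c"
      using that by (simp add: of_nat_diff algebra_simps)
    then show ?thesis using assms[of "u - c"] by linarith
  qed
  show ?thesis unfolding lower_density_def
  proof (intro conjI allI impI)
    fix x assume "x < s"
    then have "\<forall>\<^sub>F u in sequentially. C + \<bar>s * real c\<bar> \<le> (s - x) * real u"
      by (intro eventually_const_le_mult) simp
    then show "\<forall>\<^sub>F u in sequentially. x * real u \<le> N u"
      using eventually_ge_at_top[of c]
    proof eventually_elim
      case (elim u)
      then show ?case using *[of u] by (simp add: left_diff_distrib abs_le_iff)
    qed
  next
    fix x assume "s < x"
    then have "\<forall>\<^sub>F u in sequentially. C + \<bar>s * real c\<bar> \<le> (x - s) * real u"
      by (intro eventually_const_le_mult) simp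
    then have "\<forall>\<^sub>F u in sequentially. N u \<le> x * real u"
      using eventually_ge_at_top[of c]
    proof eventually_elim
      case (elim u)
      then show ?case using *[of u] by (simp add: left_diff_distrib abs_le_iff)
    qed
    then show "\<exists>\<^sub>F u in sequentially. N u \<le> x * real u"
      by (intro eventually_frequently) auto
  qed
qed

lemma tends_to_infinity_or_constant_subseq:
  fixes f :: "nat \<Rightarrow> nat"
  obtains "filterlim f at_top sequentially"
  | r c where "strict_mono (r :: nat \<Rightarrow> nat)" "\<And>k. f (r k) = c"
proof (cases "filterlim f at_top sequentially")
  case False
  then obtain Z where "\<not> (\<forall>\<^sub>F k in sequentially. Z \<le> f k)" by (auto simp: filterlim_at_top)
  then have "\<exists>\<^sub>F k in sequentially. f k < Z" by (simp add: frequently_def not_less)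
  then have inf: "infinite {k. f k < Z}" by (simp add: frequently_cofinite flip: cofinite_eq_sequentially)
  have "{k. f k < Z} = (\<Union>c<Z. {k. f k = c})" by auto
  with inf obtain c where "infinite {k. f k = c}" by (metis finite_UN finite_lessThan)
  then obtain r where "strict_mono (r :: nat \<Rightarrow> nat)" "\<And>k. r k \<in> {k. f k = c}"
    using infinite_enumerate by blast
  then show ?thesis using that(2) by auto
qed (rule that(1))

text \<open>
  Word \<open>j\<close> has period \<open>n j\<close> and mean slope \<open>s j\<close>.
\<close>

locale slope_words =
  fixes \<alpha> \<beta> :: real and n :: "nat \<Rightarrow> nat" and s :: "nat \<Rightarrow> real"
  assumes \<alpha>\<beta>: "0 \<le> \<alpha>" "\<alpha> \<le> \<beta>" "\<beta> \<le> 1"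
    and n_pos: "0 < n j" and s_bounds: "\<alpha> \<le> s j" "s j \<le> \<beta>"
begin

text \<open>
  One period: slope \<open>\<alpha>\<close> and then slope \<open>\<beta>\<close>, with the kink placed so that the value at \<open>n j\<close> is
  \<open>n j * s j\<close>. As a maximum of two lines it is convex, and inside one period only one change of
  slope can be seen.
\<close>

definition profile :: "nat \<Rightarrow> nat \<Rightarrow> real" where
  "profile j i = max (\<alpha> * i) (\<beta> * i - n j * (\<beta> - s j))"

text \<open>
  The periodic continuation of the increments of the profile.
\<close>

definition ramp :: "nat \<Rightarrow> nat \<Rightarrow> real" where
  "ramp j i = real (i div n j) * (n j * s j) + profile j (i mod n j)"

text \<open>
  The word lengths are multiples of the periods and exceed \<open>j\<close> times everything before, so that
  the average slope at the end of a word is nearly the mean slope of that word alone.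
\<close>

primrec start :: "nat \<Rightarrow> nat" where
  "start 0 = 0"
| "start (Suc j) = start j + n j * (Suc j * Suc (start j))"

definition len :: "nat \<Rightarrow> nat" where "len j = n j * (Suc j * Suc (start j))"

definition word_at :: "nat \<Rightarrow> nat" where "word_at m = (GREATEST j. start j \<le> m)"

definition height :: "nat \<Rightarrow> real" where
  "height m = (let j = word_at m in (\<Sum>i<j. len i * s i) + ramp j (m - start j))"

text \<open>
  Since the slopes lie in \<open>[0, 1]\<close>, the integer part of the height increases by \<open>0\<close> or \<open>1\<close> at each
  step; the digits record the jumps.
\<close>

definition digits :: "nat \<Rightarrow> bool" where
  "digits m \<longleftrightarrow> \<lfloor>height (Suc m)\<rfloor> \<noteq> \<lfloor>height m\<rfloor>"

lemma profile_0: "profile j 0 = 0"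
  using s_bounds[of j] by (simp add: profile_def)

lemma profile_period: "profile j (n j) = n j * s j"
proof -
  have "\<alpha> * n j \<le> n j * s j" using s_bounds[of j] by (simp add: mult.commute mult_right_mono)
  then show ?thesis by (simp add: profile_def algebra_simps)
qed

lemma profile_step: "\<alpha> \<le> profile j (Suc i) - profile j i" "profile j (Suc i) - profile j i \<le> \<beta>"
  using \<alpha>\<beta> by (auto simp: profile_def algebra_simps max_def)

lemma profile_bounds: "0 \<le> profile j i" "profile j i \<le> i"
proof -
  show "0 \<le> profile j i" using \<alpha>\<beta> by (simp add: profile_def le_max_iff_disj)
  have "\<alpha> * i \<le> 1 * real i" "\<beta> * i \<le> 1 * real i"
    using \<alpha>\<beta> mult_right_mono[of \<alpha> 1 "real i"] mult_right_mono[of \<beta> 1 "real i"] by simp_all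
  moreover have "0 \<le> n j * (\<beta> - s j)" using s_bounds[of j] by simp
  ultimately show "profile j i \<le> i" by (simp add: profile_def)
qed

lemma ramp_step: "\<alpha> \<le> ramp j (Suc i) - ramp j i" "ramp j (Suc i) - ramp j i \<le> \<beta>"
proof -
  have "ramp j (Suc i) - ramp j i = profile j (Suc (i mod n j)) - profile j (i mod n j)"
  proof (cases "Suc (i mod n j) = n j")
    case True
    then show ?thesis
      using profile_period[of j] profile_0[of j]
      by (simp add: ramp_def mod_Suc div_Suc algebra_simps)
  next
    case False
    then show ?thesis by (simp add: ramp_def mod_Suc div_Suc)
  qed
  then show "\<alpha> \<le> ramp j (Suc i) - ramp j i" "ramp j (Suc i) - ramp j i \<le> \<beta>"
    using profile_step by simp_all
qed

lemma ramp_0: "ramp j 0 = 0"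
  by (simp add: ramp_def profile_0)

lemma ramp_len: "ramp j (len j) = len j * s j"
proof -
  have "len j mod n j = 0" "len j div n j * n j = len j"
    by (simp_all add: len_def)
  then show ?thesis
    unfolding ramp_def by (simp add: profile_0 flip: of_nat_mult mult.assoc)
qed

lemma ramp_near_line: "\<bar>ramp j i - i * s j\<bar> \<le> n j"
proof -
  let ?o = "i mod n j"
  have "real i = real (i div n j) * n j + ?o"
    by (metis div_mult_mod_eq of_nat_add of_nat_mult)
  then have "i * s j = (real (i div n j) * n j + ?o) * s j" by (rule arg_cong)
  then have "i * s j = real (i div n j) * (n j * s j) + ?o * s j"
    by (simp only: distrib_right mult.assoc)
  then have "ramp j i - i * s j = profile j ?o - ?o * s j"
    unfolding ramp_def by linarith
  moreover have "?o * s j \<le> real ?o * 1" "0 \<le> ?o * s j"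
    using s_bounds[of j] \<alpha>\<beta> by (intro mult_left_mono mult_nonneg_nonneg; simp)+
  moreover have "?o < n j" using n_pos[of j] by simp
  ultimately show ?thesis using profile_bounds[of j ?o] by linarith
qed

lemma start_Suc: "start (Suc j) = start j + len j"
  by (simp add: len_def)

declare start.simps(2) [simp del]

lemma len_ge: "Suc j * Suc (start j) \<le> len j"
  using n_pos[of j] mult_le_mono1[of 1 "n j" "Suc j * Suc (start j)"] by (simp only: len_def mult_1)

lemma len_ge_Suc: "Suc j \<le> len j"
  using len_ge[of j] by (rule order_trans[rotated]) simp

lemma start_mono: "i \<le> j \<Longrightarrow> start i \<le> start j"
  by (rule lift_Suc_mono_le[of start]) (simp_all add: start_Suc)

lemma start_ge: "j \<le> start j"
proof (induction j)
  case (Suc j)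
  then show ?case using len_ge_Suc[of j] by (simp add: start_Suc)
qed simp

lemma word_at_eq: "start j \<le> m \<Longrightarrow> m < start (Suc j) \<Longrightarrow> word_at m = j"
  unfolding word_at_def
proof (rule Greatest_equality)
  fix y assume "m < start (Suc j)" "start y \<le> m"
  then show "y \<le> j" using start_mono[of "Suc j" y] by (meson le_less_trans not_less not_less_eq_eq)
qed

lemma word_at_bounds: "start (word_at m) \<le> m" "m < start (Suc (word_at m))"
proof -
  have "\<exists>j. start j \<le> m \<and> m < start (Suc j)"
  proof -
    define j where "j = (LEAST j. m < start (Suc j))"
    have "m < start (Suc m)" using start_ge[of "Suc m"] by simp
    then have *: "m < start (Suc j)" unfolding j_def by (rule LeastI)
    moreover have "start j \<le> m"
    proof (cases j)
      case (Suc i)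
      then have "\<not> m < start (Suc i)" using not_less_Least[of i "\<lambda>j. m < start (Suc j)"] by (simp add: j_def)
      then show ?thesis using Suc by simp
    qed simp
    ultimately show ?thesis by blast
  qed
  then show "start (word_at m) \<le> m" "m < start (Suc (word_at m))"
    using word_at_eq by auto
qed

lemma height_eq:
  assumes "i \<le> len j"
  shows "height (start j + i) = (\<Sum>i<j. len i * s i) + ramp j i"
proof (cases "i = len j")
  case True
  have "word_at (start (Suc j)) = Suc j"
    using len_ge_Suc[of "Suc j"] by (intro word_at_eq) (simp_all add: start_Suc)
  then show ?thesis using True
    by (simp add: height_def Let_def ramp_0 ramp_len flip: start_Suc)
next
  case False
  then have "word_at (start j + i) = j"
    using assms by (intro word_at_eq) (simp_all add: start_Suc)
  then show ?thesis by (simp add: height_def)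
qed

lemma height_zero: "height 0 = 0"
  using height_eq[of 0 0] by (simp add: ramp_0)

lemma height_diff_eq:
  "i + u \<le> len j \<Longrightarrow> height (start j + i + u) - height (start j + i) = ramp j (i + u) - ramp j i"
  using height_eq[of "i + u" j] height_eq[of i j] by (simp add: add.assoc)

lemma height_step: "\<alpha> \<le> height (Suc m) - height m" "height (Suc m) - height m \<le> \<beta>"
proof -
  define j i where "j = word_at m" and "i = m - start j"
  have "m = start j + i" "i + 1 \<le> len j"
    using word_at_bounds[of m] by (simp_all add: j_def i_def start_Suc)
  then show "\<alpha> \<le> height (Suc m) - height m" "height (Suc m) - height m \<le> \<beta>"
    using height_diff_eq[of i 1 j] ramp_step[of j i] by simp_all
qed

lemma height_diff_bounds:
  "\<alpha> * u \<le> height (m + u) - height m" "height (m + u) - height m \<le> \<beta> * u" "height (m + u) - height m \<le> u"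
proof -
  show "\<alpha> * u \<le> height (m + u) - height m"
  proof (induction u)
    case (Suc u)
    then show ?case using height_step(1)[of "m + u"] by (simp add: distrib_left)
  qed simp
  show *: "height (m + u) - height m \<le> \<beta> * u"
  proof (induction u)
    case (Suc u)
    then show ?case using height_step(2)[of "m + u"] by (simp add: distrib_left)
  qed simp
  have "\<beta> * u \<le> 1 * real u" using \<alpha>\<beta> by (intro mult_right_mono) auto
  with * show "height (m + u) - height m \<le> u" by simp
qed

lemma ones_below_digits: "int (ones_below digits m) = \<lfloor>height m\<rfloor>"
proof (induction m)
  case 0
  show ?case by (simp add: ones_below_def height_zero)
next
  case (Suc m)
  have "{l. l < Suc m \<and> digits l} = {l. l < m \<and> digits l} \<union> (if digits m then {m} else {})"
    by (auto simp: less_Suc_eq)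
  then have "ones_below digits (Suc m) = ones_below digits m + of_bool (digits m)"
    by (simp add: ones_below_def)
  moreover have "\<lfloor>height (Suc m)\<rfloor> = \<lfloor>height m\<rfloor> \<or> \<lfloor>height (Suc m)\<rfloor> = \<lfloor>height m\<rfloor> + 1"
    using height_step[of m] \<alpha>\<beta> by linarith
  ultimately show ?case using Suc by (auto simp: digits_def[of m])
qed

lemma ones_below_shift_digits: "\<bar>real (ones_below (shift m digits) u) - (height (m + u) - height m)\<bar> \<le> 1"
proof -
  have "int (ones_below (shift m digits) u) = \<lfloor>height (m + u)\<rfloor> - \<lfloor>height m\<rfloor>"
    using ones_below_add[of digits m u] ones_below_digits[of "m + u"] ones_below_digits[of m] by simp
  then have "real_of_int (int (ones_below (shift m digits) u)) = real_of_int (\<lfloor>height (m + u)\<rfloor> - \<lfloor>height m\<rfloor>)"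
    by (rule arg_cong)
  then have "real (ones_below (shift m digits) u) = real_of_int \<lfloor>height (m + u)\<rfloor> - real_of_int \<lfloor>height m\<rfloor>"
    by simp
  then show ?thesis by linarith
qed

text \<open>
  From place \<open>c\<close> on, the function \<open>N\<close> is, up to the error \<open>B\<close>, the limit of the increments of the height
  seen from the places \<open>m k\<close>. The error and the offset are parameters to let the places of
  observation move on by a constant, which is how a view that ends at a fixed distance is
  replaced by the view from the end of the period or word.
\<close>

definition follows :: "(nat \<Rightarrow> real) \<Rightarrow> real \<Rightarrow> nat \<Rightarrow> (nat \<Rightarrow> nat) \<Rightarrow> bool" where
  "follows N B c m \<longleftrightarrow>
     (\<forall>u. \<forall>\<^sub>F k in sequentially. \<bar>N (c + u) - (height (m k + u) - height (m k))\<bar> \<le> B)"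

lemma follows_subseq: "follows N B c m \<Longrightarrow> strict_mono r \<Longrightarrow> follows N B c (\<lambda>k. m (r k))"
  unfolding follows_def using eventually_subseq by blast

lemma follows_shift: "follows N B c m \<Longrightarrow> follows N (B + q) (c + q) (\<lambda>k. m k + q)"
  unfolding follows_def
proof
  fix u assume "\<forall>u. \<forall>\<^sub>F k in sequentially. \<bar>N (c + u) - (height (m k + u) - height (m k))\<bar> \<le> B"
  then have "\<forall>\<^sub>F k in sequentially. \<bar>N (c + (q + u)) - (height (m k + (q + u)) - height (m k))\<bar> \<le> B" ..
  then show "\<forall>\<^sub>F k in sequentially. \<bar>N (c + q + u) - (height (m k + q + u) - height (m k + q))\<bar> \<le> B + q"
  proof eventually_elim
    case (elim k)
    have "0 \<le> \<alpha> * q" using \<alpha>\<beta> by simp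
    then show ?case using elim height_diff_bounds[where m = "m k" and u = q] by (simp add: add.assoc)
  qed
qed

lemma follows_of_limit:
  assumes "\<And>l. \<forall>\<^sub>F k in sequentially. digits (m k + l) = w l"
  shows "follows (\<lambda>u. ones_below w u) 1 0 m"
  unfolding follows_def
proof
  fix u
  have "\<forall>\<^sub>F k in sequentially. \<forall>l<u. digits (m k + l) = w l"
    by (rule eventually_agree_below) (rule assms)
  then show "\<forall>\<^sub>F k in sequentially. \<bar>real (ones_below w (0 + u)) - (height (m k + u) - height (m k))\<bar> \<le> 1"
  proof eventually_elim
    case (elim k)
    then have "ones_below w u = ones_below (shift (m k) digits) u"
      by (intro ones_below_cong) (simp add: shift_def)
    then show ?case using ones_below_shift_digits by simp
  qed
qed

text \<open>
  A periodic function with mean slope \<open>s\<close> stays within bounded distance of a line of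
  slope \<open>s\<close>, with a bound that depends on the period only; hence the estimate survives the limit
  of the slopes.
\<close>

lemma density_constant_period:
  assumes "follows N B c (\<lambda>k. start (j k) + i k)" "filterlim (\<lambda>k. len (j k) - i k) at_top sequentially"
    and "\<And>k. n (j k) = p" "(\<lambda>k. s (j k)) \<longlonglongrightarrow> t"
  shows "lower_density N t"
proof (rule lower_density_of_bounded)
  fix u
  have "\<forall>\<^sub>F k in sequentially. \<bar>N (c + u) - s (j k) * u\<bar> \<le> B + 2 * p"
  proof -
    have "\<forall>\<^sub>F k in sequentially. Suc u \<le> len (j k) - i k"
      using assms(2) by (simp only: filterlim_at_top)
    moreover have "\<forall>\<^sub>F k in sequentially. \<bar>N (c + u) - (height (start (j k) + i k + u) - height (start (j k) + i k))\<bar> \<le> B"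
      using assms(1) by (simp add: follows_def)
    ultimately show ?thesis
    proof eventually_elim
      case (elim k)
      then have "height (start (j k) + i k + u) - height (start (j k) + i k) = ramp (j k) (i k + u) - ramp (j k) (i k)"
        by (intro height_diff_eq) simp
      moreover have "\<bar>ramp (j k) (i k + u) - (i k + u) * s (j k)\<bar> \<le> p" "\<bar>ramp (j k) (i k) - i k * s (j k)\<bar> \<le> p"
        using ramp_near_line[of "j k"] assms(3)[of k] by metis+
      ultimately show ?case using elim(2) by (simp add: algebra_simps abs_le_iff)
    qed
  qed
  moreover have "(\<lambda>k. \<bar>N (c + u) - s (j k) * u\<bar>) \<longlonglongrightarrow> \<bar>N (c + u) - t * u\<bar>"
    by (intro tendsto_intros assms(4))
  ultimately show "\<bar>N (c + u) - t * real u\<bar> \<le> B + 2 * p"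
    using tendsto_upperbound sequentially_bot by blast
qed

text \<open>
  Here \<open>e\<close> measures how far ahead of \<open>i\<close> the kink of the profile is; it is \<open>0\<close> behind the kink.
\<close>

lemma profile_diff:
  obtains e where "0 \<le> e" "\<And>u. profile j (i + u) - profile j i = max (\<alpha> * u) (\<beta> * u - e)"
proof
  define e where "e = profile j i - (\<beta> * i - n j * (\<beta> - s j))"
  show "0 \<le> e" by (simp add: e_def profile_def)
  fix u :: nat
  have "\<alpha> * u \<le> \<beta> * u" using \<alpha>\<beta> by (intro mult_right_mono) auto
  then show "profile j (i + u) - profile j i = max (\<alpha> * u) (\<beta> * u - e)"
    by (simp add: e_def profile_def max_def algebra_simps)
qed

text \<open>
  The observers see a single period for longer and longer time. If the kink moves away from
  them, the limit has slope \<open>\<alpha>\<close>; otherwise a subsequence has the kink at bounded distance and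
  the slope is eventually \<open>\<beta>\<close>.
\<close>

lemma density_long_period:
  assumes "follows N B c (\<lambda>k. start (j k) + i k)" "\<forall>\<^sub>F k in sequentially. i k < len (j k)"
    and "filterlim (\<lambda>k. n (j k) - i k mod n (j k)) at_top sequentially"
  shows "lower_density N \<alpha> \<or> lower_density N \<beta>"
proof -
  have "\<exists>e. 0 \<le> e \<and> (\<forall>u. profile (j k) (i k mod n (j k) + u) - profile (j k) (i k mod n (j k)) = max (\<alpha> * u) (\<beta> * u - e))" for k
    using profile_diff by metis
  then obtain e where e: "\<And>k. 0 \<le> e k"
    "\<And>k u. profile (j k) (i k mod n (j k) + u) - profile (j k) (i k mod n (j k)) = max (\<alpha> * u) (\<beta> * u - e k)"
    by metis
  have N: "\<forall>\<^sub>F k in sequentially. \<bar>N (c + u) - max (\<alpha> * u) (\<beta> * u - e k)\<bar> \<le> B" for u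
  proof -
    have "\<forall>\<^sub>F k in sequentially. Suc u \<le> n (j k) - i k mod n (j k)"
      using assms(3) by (simp only: filterlim_at_top)
    moreover have "\<forall>\<^sub>F k in sequentially. \<bar>N (c + u) - (height (start (j k) + i k + u) - height (start (j k) + i k))\<bar> \<le> B"
      using assms(1) by (simp add: follows_def)
    ultimately show ?thesis using assms(2)
    proof eventually_elim
      case (elim k)
      let ?n = "n (j k)" and ?o = "i k mod n (j k)" and ?q = "i k div n (j k)"
      have i: "i k = ?q * ?n + ?o" by simp
      have ou: "?o + u < ?n" using elim(1) by linarith
      have "?q < Suc (j k) * Suc (start (j k))"
        using elim(3) n_pos[of "j k"] by (simp add: len_def less_mult_imp_div_less mult.commute)
      then have "Suc ?q * ?n \<le> len (j k)"
        unfolding len_def by (metis Suc_leI mult.commute mult_le_mono1)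
      moreover have iu: "i k + u = ?q * ?n + (?o + u)" using i by linarith
      ultimately have le: "i k + u \<le> len (j k)" using ou unfolding mult_Suc by linarith
      have gen: "(a * b + d) div b = a" "(a * b + d) mod b = d" if "d < b" for a b d :: nat
        using that by simp_all
      have "(i k + u) div ?n = ?q" "(i k + u) mod ?n = ?o + u"
        unfolding iu using gen[OF ou] by blast+
      then have "ramp (j k) (i k + u) - ramp (j k) (i k) = max (\<alpha> * u) (\<beta> * u - e k)"
        by (simp add: ramp_def flip: e(2))
      then show ?case using elim(2) height_diff_eq[OF le] by simp
    qed
  qed
  show ?thesis
  proof (rule tends_to_infinity_or_constant_subseq[of "\<lambda>k. nat \<lceil>e k\<rceil>"])
    assume inf: "filterlim (\<lambda>k. nat \<lceil>e k\<rceil>) at_top sequentially"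
    have "\<bar>N (c + u) - \<alpha> * u\<bar> \<le> B" for u
    proof -
      have "\<forall>\<^sub>F k in sequentially. Suc u \<le> nat \<lceil>e k\<rceil>"
        using inf by (simp only: filterlim_at_top)
      then have "\<forall>\<^sub>F k in sequentially. \<bar>N (c + u) - \<alpha> * u\<bar> \<le> B"
        using N[of u]
      proof eventually_elim
        case (elim k)
        then have "real u < e k" by linarith
        moreover have "\<beta> * u \<le> 1 * real u" "0 \<le> \<alpha> * u"
          using \<alpha>\<beta> mult_right_mono[of \<beta> 1 "real u"] by simp_all
        ultimately show ?case using elim(2) by (simp add: max_def)
      qed
      then show ?thesis by simp
    qed
    then show ?thesis using lower_density_of_bounded by blast
  next
    fix r q assume r: "strict_mono (r :: nat \<Rightarrow> nat)" "\<And>k. nat \<lceil>e (r k)\<rceil> = q"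
    have "\<bar>N (c + u) - \<beta> * u\<bar> \<le> B + q" for u
    proof -
      have "\<forall>\<^sub>F k in sequentially. \<bar>N (c + u) - \<beta> * u\<bar> \<le> B + q"
        using eventually_subseq[OF r(1) N[of u]]
      proof eventually_elim
        case (elim k)
        have "e (r k) \<le> q" "0 \<le> e (r k)" using r(2)[of k] e(1)[of "r k"] by linarith+
        moreover have "\<alpha> * u \<le> \<beta> * u" using \<alpha>\<beta> by (intro mult_right_mono) auto
        ultimately show ?case using elim by (auto simp: max_def abs_le_iff split: if_splits)
      qed
      then show ?thesis by simp
    qed
    then show ?thesis using lower_density_of_bounded by blast
  qed
qed

text \<open>
  Either the periods are constant along a subsequence, or they tend to infinity. In the second
  case the end of the current period may be at a bounded distance; then the observers move there,
  to the beginning of a period.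
\<close>

lemma density_inside_words:
  assumes "follows N B c (\<lambda>k. start (j k) + i k)" "filterlim (\<lambda>k. len (j k) - i k) at_top sequentially"
    and K: "\<And>p. compact (K p)" "\<And>j. s j \<in> K (n j)"
  shows "\<exists>t \<in> {\<alpha>, \<beta>} \<union> (\<Union>p. K p). lower_density N t"
proof -
  have inside: "\<forall>\<^sub>F k in sequentially. i k + q < len (j k)" for q
  proof -
    have "\<forall>\<^sub>F k in sequentially. Suc q \<le> len (j k) - i k"
      using assms(2) by (simp only: filterlim_at_top)
    then show ?thesis by eventually_elim linarith
  qed
  show ?thesis
  proof (rule tends_to_infinity_or_constant_subseq[of "\<lambda>k. n (j k)"])
    fix r p assume r: "strict_mono (r :: nat \<Rightarrow> nat)" "\<And>k. n (j (r k)) = p"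
    have "\<And>k. s (j (r k)) \<in> K p" using K(2) r(2) by metis
    then obtain t r' where t: "t \<in> K p" "strict_mono (r' :: nat \<Rightarrow> nat)" "((\<lambda>k. s (j (r k))) \<circ> r') \<longlonglongrightarrow> t"
      using K(1)[of p] unfolding compact_eq_seq_compact_metric seq_compact_def by metis
    have rr: "strict_mono (\<lambda>k. r (r' k))" using r(1) t(2) by (simp add: strict_mono_def)
    have "lower_density N t"
    proof (rule density_constant_period)
      show "follows N B c (\<lambda>k. start (j (r (r' k))) + i (r (r' k)))"
        using follows_subseq[OF assms(1) rr] by simp
      show "filterlim (\<lambda>k. len (j (r (r' k))) - i (r (r' k))) at_top sequentially"
        using filterlim_compose[OF assms(2) filterlim_subseq[OF rr]] by simp
    qed (use r t in \<open>auto simp: o_def\<close>)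
    then show ?thesis using t by blast
  next
    assume inf: "filterlim (\<lambda>k. n (j k)) at_top sequentially"
    have "lower_density N \<alpha> \<or> lower_density N \<beta>"
    proof (rule tends_to_infinity_or_constant_subseq[of "\<lambda>k. n (j k) - i k mod n (j k)"])
      assume "filterlim (\<lambda>k. n (j k) - i k mod n (j k)) at_top sequentially"
      then show ?thesis using density_long_period[OF assms(1)] inside[of 0] by simp
    next
      fix r q assume r: "strict_mono (r :: nat \<Rightarrow> nat)" "\<And>k. n (j (r k)) - i (r k) mod n (j (r k)) = q"
      show ?thesis
      proof (rule density_long_period)
        show "follows N (B + q) (c + q) (\<lambda>k. start (j (r k)) + (i (r k) + q))"
          using follows_shift[OF follows_subseq[OF assms(1) r(1)], of q] by (simp add: add.assoc)
        show "\<forall>\<^sub>F k in sequentially. i (r k) + q < len (j (r k))"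
          using eventually_subseq[OF r(1) inside] .
        have "(i (r k) + q) mod n (j (r k)) = 0" for k
        proof -
          have "i (r k) mod n (j (r k)) < n (j (r k))" using n_pos by simp
          then have "i (r k) mod n (j (r k)) + q = n (j (r k))" using r(2)[of k] by linarith
          then show ?thesis by (metis mod_add_left_eq mod_self)
        qed
        then show "filterlim (\<lambda>k. n (j (r k)) - (i (r k) + q) mod n (j (r k))) at_top sequentially"
          using filterlim_compose[OF inf filterlim_subseq[OF r(1)]] by simp
      qed
    qed
    then show ?thesis by blast
  qed
qed

text \<open>
  The slopes are at least \<open>\<alpha>\<close>, and at the end of a word with mean slope near \<open>\<alpha>\<close>
  the average from the beginning is near \<open>\<alpha>\<close> as well.
\<close>

lemma density_of_tail:
  assumes low: "\<And>\<epsilon> J. 0 < \<epsilon> \<Longrightarrow> \<exists>j\<ge>J. s j < \<alpha> + \<epsilon>"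
    and N: "\<And>u. \<bar>N u - (height (c + u) - height c)\<bar> \<le> 1"
  shows "lower_density N \<alpha>"
  unfolding lower_density_def
proof (intro conjI allI impI)
  fix x assume "x < \<alpha>"
  then have "\<forall>\<^sub>F u in sequentially. 1 \<le> (\<alpha> - x) * real u"
    by (intro eventually_const_le_mult) simp
  then show "\<forall>\<^sub>F u in sequentially. x * real u \<le> N u"
  proof eventually_elim
    case (elim u)
    then show ?case using N[of u] height_diff_bounds(1)[where m = c and u = u] by (simp add: left_diff_distrib)
  qed
next
  fix x assume "\<alpha> < x"
  \<comment> \<open>three error terms: the slope of the word, what precedes the word, and the additive constants\<close>
  define \<epsilon> where "\<epsilon> = (x - \<alpha>) / 3"
  have "0 < \<epsilon>" using \<open>\<alpha> < x\<close> by (simp add: \<epsilon>_def)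
  show "\<exists>\<^sub>F u in sequentially. N u \<le> x * real u"
    unfolding frequently_sequentially
  proof
    fix U :: nat
    obtain J where J: "1 / \<epsilon> + (1 + x * c) / \<epsilon> + U + c \<le> real J" using real_arch_simple by blast
    obtain j where j: "J \<le> j" "s j < \<alpha> + \<epsilon>" using low[OF \<open>0 < \<epsilon>\<close>] by blast
    have "0 < x" using \<open>\<alpha> < x\<close> \<alpha>\<beta> by simp
    have "0 \<le> (1 + x * c) / \<epsilon>" "0 \<le> 1 / \<epsilon>" using \<open>0 < x\<close> \<open>0 < \<epsilon>\<close> by simp_all
    then have "real U + real c \<le> real J" using J by linarith
    then have "U + c \<le> J" by (simp flip: of_nat_add)
    define L where "L = len j"
    have L: "Suc j \<le> L" "Suc j * start j \<le> L"
      using len_ge_Suc[of j] len_ge[of j] by (simp_all add: L_def)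
    define u where "u = start (Suc j) - c"
    have u: "c + u = start j + L" "U \<le> u"
      using L \<open>U + c \<le> J\<close> j by (simp_all add: u_def start_Suc L_def)
    have "height (c + u) = height (start j) + L * s j"
      using height_diff_eq[of 0 L j] u by (simp add: L_def ramp_0 ramp_len)
    also have "height (start j) \<le> start j"
      using height_diff_bounds(3)[where m = 0 and u = "start j"] by (simp add: height_zero)
    also have "start j \<le> \<epsilon> * L"
    proof -
      have "1 / \<epsilon> \<le> Suc j" using J j \<open>0 \<le> (1 + x * c) / \<epsilon>\<close> by simp
      then have "1 \<le> \<epsilon> * Suc j" using \<open>0 < \<epsilon>\<close> by (simp add: field_simps)
      then have "1 * real (start j) \<le> \<epsilon> * Suc j * start j" by (intro mult_right_mono) auto
      also have "\<dots> \<le> \<epsilon> * L"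
        using mult_left_mono[OF of_nat_mono[OF L(2)], of \<epsilon>] \<open>0 < \<epsilon>\<close>
        by (simp only: of_nat_mult mult.assoc less_imp_le)
      finally show ?thesis by simp
    qed
    also have "L * s j \<le> L * (\<alpha> + \<epsilon>)" using j by (intro mult_left_mono) auto
    finally have h: "height (c + u) \<le> \<epsilon> * L + L * (\<alpha> + \<epsilon>)" by simp
    have "0 \<le> height c"
    proof -
      have "0 \<le> \<alpha> * c" using \<alpha>\<beta> by simp
      then show ?thesis using height_diff_bounds(1)[where m = 0 and u = c] by (simp add: height_zero)
    qed
    then have "N u \<le> 1 + \<epsilon> * L + L * (\<alpha> + \<epsilon>)" using N[of u] h by (simp add: abs_le_iff)
    also have "\<dots> = 1 + x * L - \<epsilon> * L" by (simp add: \<epsilon>_def field_simps)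
    also have "\<dots> \<le> x * L - x * c"
    proof -
      have "(1 + x * c) / \<epsilon> \<le> real J" using J \<open>0 \<le> 1 / \<epsilon>\<close> by linarith
      also have "real J \<le> real L" using L(1) j(1) by simp
      finally have "(1 + x * c) / \<epsilon> \<le> L" .
      then have "1 + x * c \<le> \<epsilon> * L" using \<open>0 < \<epsilon>\<close> by (simp add: field_simps)
      then show ?thesis by simp
    qed
    also have "\<dots> \<le> x * u"
    proof -
      have "real L - real c \<le> u" using u(1) by linarith
      then show ?thesis using \<open>0 < x\<close> by (simp flip: right_diff_distrib)
    qed
    finally show "\<exists>u\<ge>U. N u \<le> x * real u" using u(2) by blast
  qed
qed

text \<open>
  Observers that do not tend to infinity see a shift of the whole sequence. Otherwise they
  are in words of increasing index, and if the end of the word stays at bounded distance they move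
  there, to the beginning of a long word.
\<close>

lemma density_of_limit:
  assumes K: "\<And>p. compact (K p)" "\<And>j. s j \<in> K (n j)"
    and low: "\<And>\<epsilon> J. 0 < \<epsilon> \<Longrightarrow> \<exists>j\<ge>J. s j < \<alpha> + \<epsilon>"
    and lim: "\<And>l. \<forall>\<^sub>F k in sequentially. digits (m k + l) = w l"
  shows "\<exists>t \<in> {\<alpha>, \<beta>} \<union> (\<Union>p. K p). lower_density (ones_below w) t"
proof (rule tends_to_infinity_or_constant_subseq[of m])
  fix r c assume r: "strict_mono (r :: nat \<Rightarrow> nat)" "\<And>k. m (r k) = c"
  have "\<bar>ones_below w u - (height (c + u) - height c)\<bar> \<le> 1" for u
    using follows_subseq[OF follows_of_limit[OF lim] r(1)] r(2) by (simp add: follows_def)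
  then have "lower_density (ones_below w) \<alpha>" by (intro density_of_tail[OF low])
  then show ?thesis by blast
next
  assume inf: "filterlim m at_top sequentially"
  define j i where "j k = word_at (m k)" and "i k = m k - start (j k)" for k
  have m: "m k = start (j k) + i k" for k
    using word_at_bounds[of "m k"] by (simp add: j_def i_def)
  have il: "i k < len (j k)" for k
    using word_at_bounds[of "m k"] by (simp add: j_def i_def start_Suc)
  have jinf: "filterlim j at_top sequentially"
    unfolding filterlim_at_top
  proof
    fix Z
    have "\<forall>\<^sub>F k in sequentially. start Z \<le> m k"
      using inf by (simp only: filterlim_at_top)
    then show "\<forall>\<^sub>F k in sequentially. Z \<le> j k"
    proof eventually_elim
      case (elim k)
      show ?case
      proof (rule ccontr)
        assume "\<not> Z \<le> j k"
        then have "start (Suc (j k)) \<le> start Z" by (intro start_mono) simp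
        then show False using elim word_at_bounds(2)[of "m k"] by (simp add: j_def)
      qed
    qed
  qed
  have fol: "follows (ones_below w) 1 0 (\<lambda>k. start (j k) + i k)"
    using follows_of_limit[OF lim] unfolding m .
  show ?thesis
  proof (rule tends_to_infinity_or_constant_subseq[of "\<lambda>k. len (j k) - i k"])
    assume "filterlim (\<lambda>k. len (j k) - i k) at_top sequentially"
    then show ?thesis by (rule density_inside_words[OF fol _ K])
  next
    fix r q assume r: "strict_mono (r :: nat \<Rightarrow> nat)" "\<And>k. len (j (r k)) - i (r k) = q"
    have eq: "start (j (r k)) + i (r k) + q = start (Suc (j (r k))) + 0" for k
      using r(2)[of k] il[of "r k"] by (simp add: start_Suc)
    show ?thesis
    proof (rule density_inside_words[OF _ _ K])
      show "follows (ones_below w) (1 + real q) (0 + q) (\<lambda>k. start (Suc (j (r k))) + 0)"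
        using follows_shift[OF follows_subseq[OF fol r(1)], of q] unfolding eq .
      have "filterlim (\<lambda>k. j (r k)) at_top sequentially"
        by (rule filterlim_compose[OF jinf filterlim_subseq[OF r(1)]])
      then show "filterlim (\<lambda>k. len (Suc (j (r k))) - 0) at_top sequentially"
        by (rule filterlim_at_top_mono) (use len_ge_Suc in \<open>auto intro!: always_eventually intro: Suc_leD\<close>)
    qed
  qed
qed

lemma density_attained:
  assumes "\<And>\<epsilon> J. 0 < \<epsilon> \<Longrightarrow> \<exists>j\<ge>J. n j = p \<and> \<bar>s j - t\<bar> < \<epsilon>"
  shows "\<exists>m w. (\<forall>l. \<forall>\<^sub>F k in sequentially. digits (m k + l) = w l) \<and> lower_density (ones_below w) t"
proof -
  have "\<exists>j\<ge>k. n j = p \<and> \<bar>s j - t\<bar> < inverse (Suc k)" for k by (rule assms) simp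
  then obtain j where j: "\<And>k. k \<le> j k" "\<And>k. n (j k) = p" "\<And>k. \<bar>s (j k) - t\<bar> < inverse (Suc k)" by metis
  obtain r w where r: "strict_mono (r :: nat \<Rightarrow> nat)" and w: "\<And>l. \<forall>\<^sub>F k in sequentially. shift (start (j (r k))) digits l = w l"
    using bool_sequences_subseq[of "\<lambda>k. shift (start (j k)) digits"] by blast
  have lim: "\<forall>\<^sub>F k in sequentially. digits (start (j (r k)) + l) = w l" for l
    using w[of l] by (simp add: shift_def)
  have "(\<lambda>k. s (j k)) \<longlonglongrightarrow> t"
  proof (rule LIM_zero_cancel, rule Lim_null_comparison[OF _ LIMSEQ_inverse_real_of_nat])
    show "\<forall>\<^sub>F k in sequentially. norm (s (j k) - t) \<le> inverse (real (Suc k))"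
      using j(3) by (auto intro!: always_eventually less_imp_le simp del: of_nat_Suc)
  qed
  then have st: "(\<lambda>k. s (j (r k))) \<longlonglongrightarrow> t"
    using LIMSEQ_subseq_LIMSEQ[OF _ r] by (simp add: o_def)
  have "lower_density (ones_below w) t"
  proof (rule density_constant_period[where i = "\<lambda>k. 0"])
    show "follows (ones_below w) 1 0 (\<lambda>k. start (j (r k)) + 0)"
      using follows_of_limit[OF lim] by simp
    have "k \<le> len (j (r k)) - 0" for k
      using seq_suble[OF r, of k] j(1)[of "r k"] len_ge_Suc[of "j (r k)"] by simp
    then show "filterlim (\<lambda>k. len (j (r k)) - 0) at_top sequentially"
      by (intro filterlim_at_top_mono[OF filterlim_ident]) (auto intro!: always_eventually)
  qed (use j st in auto)
  then show ?thesis
    using lim by (intro exI[of _ "\<lambda>k. start (j (r k))"] exI[of _ w]) simp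
qed

end

text \<open>
  Countable dense subsets of the \<open>K p\<close> are enumerated with every element repeated infinitely often.
\<close>

lemma enumerate_dense:
  fixes K :: "nat \<Rightarrow> real set"
  assumes "(\<Union>p. K p) \<noteq> {}"
  shows "\<exists>(n :: nat \<Rightarrow> nat) s. (\<forall>j. s j \<in> K (n j)) \<and>
    (\<forall>p t \<epsilon> J. t \<in> K p \<longrightarrow> 0 < \<epsilon> \<longrightarrow> (\<exists>j\<ge>J. n j = p \<and> \<bar>s j - t\<bar> < \<epsilon>))"
proof -
  have "\<exists>D. countable D \<and> D \<subseteq> K p \<and> K p \<subseteq> closure D" for p
    using separable[of "K p"] by metis
  then obtain D where D: "\<And>p. countable (D p)" "\<And>p. D p \<subseteq> K p" "\<And>p. K p \<subseteq> closure (D p)" by metis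
  define P where "P = (SIGMA p:UNIV. D p)"
  have P: "countable P" unfolding P_def using D by (intro countable_SIGMA) auto
  obtain p0 where "K p0 \<noteq> {}" using assms by blast
  then have "D p0 \<noteq> {}" using D(3)[of p0] by auto
  then have ne: "P \<noteq> {}" by (auto simp: P_def)
  define f where "f j = from_nat_into P (fst (prod_decode j))" for j
  show ?thesis
  proof (intro exI[of _ "\<lambda>j. snd (f j)"] exI[of _ "\<lambda>j. fst (f j)"] conjI allI impI)
    show "snd (f j) \<in> K (fst (f j))" for j
      using from_nat_into[OF ne, of "fst (prod_decode j)"] subsetD[OF D(2)]
      unfolding f_def by (auto simp: P_def)
    fix p t and \<epsilon> :: real and J assume "t \<in> K p" "0 < \<epsilon>"
    then obtain y where y: "y \<in> D p" "dist y t < \<epsilon>"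
      using D(3)[of p] by (meson closure_approachable subsetD)
    then have "(p, y) \<in> P" by (simp add: P_def)
    then obtain i where i: "from_nat_into P i = (p, y)"
      using from_nat_into_surj[OF P] by blast
    have "f (prod_encode (i, J)) = (p, y)" by (simp add: f_def i)
    moreover have "J \<le> prod_encode (i, J)" by (rule le_prod_encode_2)
    ultimately show "\<exists>j\<ge>J. fst (f j) = p \<and> \<bar>snd (f j) - t\<bar> < \<epsilon>"
      using y(2) by (intro exI[of _ "prod_encode (i, J)"]) (simp add: dist_real_def)
  qed
qed

lemma sequence_with_limit_densities:
  fixes K :: "nat \<Rightarrow> real set"
  assumes closed: "\<And>p. closed (K p)" and bounds: "0 \<le> \<alpha>" "\<beta> \<le> 1" "(\<Union>p. K p) \<subseteq> {\<alpha>..\<beta>}"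
    and ends: "\<alpha> \<in> (\<Union>p. K p)" "\<beta> \<in> (\<Union>p. K p)"
  obtains w where
    "\<And>m w'. (\<And>l. \<forall>\<^sub>F k in sequentially. w (m k + l) = w' l) \<Longrightarrow> \<exists>t \<in> (\<Union>p. K p). lower_density (ones_below w') t"
    "\<And>t. t \<in> (\<Union>p. K p) \<Longrightarrow>
      \<exists>m w'. (\<forall>l. \<forall>\<^sub>F k in sequentially. w (m k + l) = w' l) \<and> lower_density (ones_below w') t"
proof -
  \<comment> \<open>the index is shifted because a period is positive\<close>
  define K' where "K' p = (if p = 0 then {} else K (p - 1))" for p
  have UK: "(\<Union>p. K' p) = (\<Union>p. K p)"
  proof (intro equalityI subsetI)
    fix x assume "x \<in> (\<Union>p. K p)"
    then obtain p where "x \<in> K' (Suc p)" by (auto simp: K'_def)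
    then show "x \<in> (\<Union>p. K' p)" by blast
  qed (auto simp: K'_def split: if_splits)
  have "(\<Union>p. K' p) \<noteq> {}" using UK ends by blast
  from enumerate_dense[OF this] obtain n :: "nat \<Rightarrow> nat" and s where ns: "(\<forall>j. s j \<in> K' (n j)) \<and>
    (\<forall>p t \<epsilon> J. t \<in> K' p \<longrightarrow> 0 < \<epsilon> \<longrightarrow> (\<exists>j\<ge>J. n j = p \<and> \<bar>s j - t\<bar> < \<epsilon>))"
    by (elim exE)
  have s: "s j \<in> K' (n j)" for j using ns by simp
  have dense: "\<exists>j\<ge>J. n j = p \<and> \<bar>s j - t\<bar> < \<epsilon>" if "t \<in> K' p" "0 < \<epsilon>" for p t \<epsilon> J
    using ns that by simp
  have sb: "s j \<in> {\<alpha>..\<beta>}" for j using s[of j] UK bounds by blast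
  interpret slope_words \<alpha> \<beta> n s
  proof
    show "0 < n j" for j using s[of j] by (cases "n j") (auto simp: K'_def)
    show "\<alpha> \<le> s j" "s j \<le> \<beta>" for j using sb[of j] by auto
    show "\<alpha> \<le> \<beta>" using sb[of 0] by auto
  qed (use bounds in auto)
  have comp: "compact (K' p)" for p
  proof (rule compact_Int_closed[of "{\<alpha>..\<beta>}" "K' p", THEN back_subst[of compact]])
    show "closed (K' p)" using closed by (simp add: K'_def)
    show "{\<alpha>..\<beta>} \<inter> K' p = K' p" using UK bounds by blast
  qed auto
  have low: "\<exists>j\<ge>J. s j < \<alpha> + \<epsilon>" if \<epsilon>: "0 < \<epsilon>" for \<epsilon> J
  proof -
    obtain p where "\<alpha> \<in> K' p" using ends UK by blast
    then obtain j where "J \<le> j" "\<bar>s j - \<alpha>\<bar> < \<epsilon>" using dense[OF _ \<epsilon>] by blast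
    then show ?thesis by (intro exI[of _ j]) auto
  qed
  show ?thesis
  proof (rule that[of digits])
    fix m w' assume "\<And>l. \<forall>\<^sub>F k in sequentially. digits (m k + l) = w' l"
    from density_of_limit[OF comp s low this]
    show "\<exists>t \<in> (\<Union>p. K p). lower_density (ones_below w') t" using UK ends by auto
  next
    fix t assume "t \<in> (\<Union>p. K p)"
    then obtain p where "t \<in> K' p" using UK by blast
    then show "\<exists>m w'. (\<forall>l. \<forall>\<^sub>F k in sequentially. digits (m k + l) = w' l) \<and> lower_density (ones_below w') t"
      by (rule density_attained[OF dense])
  qed
qed

section \<open>Minisets of digit sets and their limits\<close>

lemma infdist_le_hausdorff_dist:
  fixes D E :: "'a::metric_space set"
  assumes "compact D" "compact E"
  shows "a \<in> D \<Longrightarrow> infdist a E \<le> hausdorff_dist D E" "b \<in> E \<Longrightarrow> infdist b D \<le> hausdorff_dist D E"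
proof -
  have bdd: "bdd_above ((\<lambda>x. infdist x B) ` A)" if "compact A" for A B :: "'a set"
    using that by (intro bounded_imp_bdd_above compact_imp_bounded compact_continuous_image continuous_intros)
  show "infdist a E \<le> hausdorff_dist D E" if "a \<in> D"
    unfolding hausdorff_dist_def using cSUP_upper[OF that bdd[OF assms(1)]] by (rule max.coboundedI1)
  show "infdist b D \<le> hausdorff_dist D E" if "b \<in> E"
    unfolding hausdorff_dist_def using cSUP_upper[OF that bdd[OF assms(2)]] by (rule max.coboundedI2)
qed

lemma hausdorff_dist_le:
  fixes D E :: "'a::metric_space set"
  assumes "D \<noteq> {}" "E \<noteq> {}"
    and "\<And>a. a \<in> D \<Longrightarrow> \<exists>b\<in>E. dist a b \<le> r" "\<And>b. b \<in> E \<Longrightarrow> \<exists>a\<in>D. dist b a \<le> r"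
  shows "hausdorff_dist D E \<le> r"
  unfolding hausdorff_dist_def
proof (rule max.boundedI)
  show "(SUP a\<in>D. infdist a E) \<le> r"
    using assms(1,3) by (intro cSUP_least) (auto intro: infdist_le2)
  show "(SUP b\<in>E. infdist b D) \<le> r"
    using assms(2,4) by (intro cSUP_least) (auto intro: infdist_le2)
qed

lemma bintrunc_dyadic: "\<exists>a::nat. 2 ^ n * bintrunc n e = real a"
  using bintrunc_set_encode[of n "{l. e l}"] by auto

lemma dist_le_of_components:
  fixes x y :: "real ^ 'n::finite" and r :: real
  assumes "\<And>i. \<bar>x $ i - y $ i\<bar> \<le> r"
  shows "dist x y \<le> real CARD('n) * r"
proof -
  have "dist x y \<le> (\<Sum>i\<in>UNIV. \<bar>(x - y) $ i\<bar>)" unfolding dist_norm by (rule norm_le_l1_cart)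
  also have "\<dots> \<le> (\<Sum>i\<in>(UNIV::'n set). r)" using assms by (intro sum_mono) auto
  finally show ?thesis by simp
qed

text \<open>
  Writing the scale as \<open>\<gamma> 2\<^sup>m\<close> splits an expansion after \<open>m\<close> places. The head is an integer multiple of
  \<open>\<gamma>\<close> after scaling, and in each coordinate only three of these multiples bring the piece near the unit
  interval. The next \<open>q\<close> places determine the point up to \<open>\<gamma> 2\<^sup>-\<^sup>q\<close>.
\<close>

lemma miniset_cover:
  fixes t :: "real ^ 'n::finite"
  assumes \<gamma>: "1 \<le> \<gamma>" "\<gamma> \<le> 2"
  shows "\<exists>Y. finite Y \<and> card Y \<le> (3 * 2 ^ ones_below (shift m w) q) ^ CARD('n) \<and>
    (\<forall>x \<in> (\<lambda>x. (\<gamma> * 2 ^ m) *\<^sub>R x + t) ` digit_set w \<inter> unit_cube. \<exists>y\<in>Y. dist x y \<le> CARD('n) * (2 / 2 ^ q))"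
proof -
  \<comment> \<open>the smallest integer part that can occur in coordinate \<open>i\<close>\<close>
  define z where "z i = \<lceil>- (t $ i) / \<gamma> - 1\<rceil>" for i
  define P where "P = (UNIV :: 'n set) \<rightarrow>\<^sub>E {0..2::nat} \<times> Pow {l. l < q \<and> shift m w l}"
  define pt where "pt p = (\<chi> i. \<gamma> * (z i + real (fst (p i))) + \<gamma> * bintrunc q (\<lambda>l. l \<in> snd (p i)) + t $ i)"
    for p :: "'n \<Rightarrow> nat \<times> nat set"
  have fin: "finite P" unfolding P_def by (intro finite_PiE) auto
  have "card (pt ` P) \<le> card P" by (rule card_image_le[OF fin])
  also have "\<dots> = (3 * 2 ^ ones_below (shift m w) q) ^ CARD('n)"
    by (simp add: P_def card_PiE card_cartesian_product card_Pow ones_below_def)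
  finally have card: "card (pt ` P) \<le> (3 * 2 ^ ones_below (shift m w) q) ^ CARD('n)" .
  have "\<exists>y\<in>pt ` P. dist x y \<le> CARD('n) * (2 / 2 ^ q)"
    if x: "x \<in> (\<lambda>x. (\<gamma> * 2 ^ m) *\<^sub>R x + t) ` digit_set w" "x \<in> unit_cube" for x
  proof -
    obtain e where e: "\<And>i l. e i l \<Longrightarrow> w l" and xe: "x = (\<gamma> * 2 ^ m) *\<^sub>R (\<chi> i. binval (e i)) + t"
      using x(1) by (auto elim!: digit_setE)
    have "\<forall>i. \<exists>a. 2 ^ m * bintrunc m (e i) = real a" using bintrunc_dyadic by blast
    then obtain a where a: "\<And>i. 2 ^ m * bintrunc m (e i) = real (a i)" by metis
    have xi: "x $ i = \<gamma> * a i + \<gamma> * binval (shift m (e i)) + t $ i" for i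
      using binval_split[of "e i" m] by (simp add: xe algebra_simps flip: a)
    have ai: "z i \<le> int (a i)" "int (a i) \<le> z i + 2" for i
    proof -
      have "0 \<le> x $ i" "x $ i \<le> 1" using x(2) by (auto simp: mem_box_cart)
      moreover have "0 \<le> \<gamma> * binval (shift m (e i))" "\<gamma> * binval (shift m (e i)) \<le> \<gamma>"
        using \<gamma> binval_nonneg binval_le_1[of "shift m (e i)"] by (auto intro: mult_left_le)
      ultimately have "- (t $ i) - \<gamma> \<le> \<gamma> * a i" "\<gamma> * a i \<le> 1 - t $ i" by (simp_all add: xi)
      then have "- (t $ i) / \<gamma> - 1 \<le> a i" "a i \<le> 1 / \<gamma> + - (t $ i) / \<gamma>"
        using \<gamma> by (simp_all add: field_simps)
      moreover have "1 / \<gamma> \<le> 1" using \<gamma> by simp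
      ultimately show "z i \<le> int (a i)" "int (a i) \<le> z i + 2"
        unfolding z_def by linarith+
    qed
    define p where "p i = (nat (int (a i) - z i), {l. l < q \<and> shift m (e i) l})" for i
    have "int (a i) - z i \<le> 2" for i using ai(2)[of i] by simp
    then have "p \<in> P" using e by (auto simp: P_def p_def shift_def nat_le_iff)
    moreover have "dist x (pt p) \<le> CARD('n) * (2 / 2 ^ q)"
    proof (rule dist_le_of_components)
      fix i
      have "real (nat (int (a i) - z i)) = a i - z i" using ai(1)[of i] by simp
      moreover have "bintrunc q (\<lambda>l. l < q \<and> shift m (e i) l) = bintrunc q (shift m (e i))"
        by (rule bintrunc_cong) simp
      ultimately have "x $ i - pt p $ i = \<gamma> * (binval (shift m (e i)) - bintrunc q (shift m (e i)))"
        by (simp add: xi pt_def p_def algebra_simps)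
      then have "\<bar>x $ i - pt p $ i\<bar> = \<gamma> * (binval (shift m (e i)) - bintrunc q (shift m (e i)))"
        using \<gamma> bintrunc_le_binval[of q "shift m (e i)"] by simp
      also have "\<dots> \<le> 2 * (1 / 2 ^ q)"
        using \<gamma> bintrunc_le_binval[of q "shift m (e i)"] binval_le_bintrunc[of "shift m (e i)" q]
        by (intro mult_mono) auto
      finally show "\<bar>x $ i - pt p $ i\<bar> \<le> 2 / 2 ^ q" by simp
    qed
    ultimately show ?thesis by blast
  qed
  then show ?thesis using card fin by blast
qed

lemma zero_in_digit_set: "0 \<in> (digit_set w :: (real ^ 'n::finite) set)"
proof -
  have "(\<chi> i. binval (\<lambda>l. False)) \<in> (digit_set w :: (real ^ 'n) set)" by (rule digit_setI) simp
  then show ?thesis by (simp add: binval_def zero_vec_def)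
qed

text \<open>
  The first \<open>m + q\<close> digits of \<open>y\<close> are kept and followed by arbitrary admissible ones.
\<close>

lemma copy_around_point:
  fixes t :: "real ^ 'n::finite"
  assumes \<gamma>: "1 \<le> \<gamma>" "\<gamma> \<le> 2" and y: "y \<in> (\<lambda>x. (\<gamma> * 2 ^ m) *\<^sub>R x + t) ` digit_set w"
  shows "\<exists>v. \<forall>u \<in> digit_set (shift (m + q) w).
    v + (\<gamma> / 2 ^ q) *\<^sub>R u \<in> (\<lambda>x. (\<gamma> * 2 ^ m) *\<^sub>R x + t) ` digit_set w \<and>
    dist y (v + (\<gamma> / 2 ^ q) *\<^sub>R u) \<le> CARD('n) * (2 / 2 ^ q)"
proof -
  obtain e where e: "\<And>i l. e i l \<Longrightarrow> w l" and ye: "y = (\<gamma> * 2 ^ m) *\<^sub>R (\<chi> i. binval (e i)) + t"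
    using y by (auto elim!: digit_setE)
  define v where "v = (\<gamma> * 2 ^ m) *\<^sub>R (\<chi> i. bintrunc (m + q) (e i)) + t"
  have "v + (\<gamma> / 2 ^ q) *\<^sub>R u \<in> (\<lambda>x. (\<gamma> * 2 ^ m) *\<^sub>R x + t) ` digit_set w \<and>
    dist y (v + (\<gamma> / 2 ^ q) *\<^sub>R u) \<le> CARD('n) * (2 / 2 ^ q)" if "u \<in> digit_set (shift (m + q) w)" for u
  proof
    from digit_setD[OF \<open>u \<in> _\<close>] obtain f where f: "\<forall>i l. f i l \<longrightarrow> shift (m + q) w l"
      and u: "u = (\<chi> i. binval (f i))" by (elim exE conjE)
    note f = f[rule_format]
    define g where "g i = (\<lambda>l. if l < m + q then e i l else f i (l - (m + q)))" for i
    have "w l" if "g i l" for i l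
      using that e[of i l] f[of i "l - (m + q)"] by (auto simp: g_def shift_def split: if_splits)
    then have "(\<chi> i. binval (g i)) \<in> digit_set w" by (rule digit_setI)
    moreover have "v + (\<gamma> / 2 ^ q) *\<^sub>R u = (\<gamma> * 2 ^ m) *\<^sub>R (\<chi> i. binval (g i)) + t"
      by (simp add: vec_eq_iff v_def u g_def binval_append power_add field_simps)
    ultimately show "v + (\<gamma> / 2 ^ q) *\<^sub>R u \<in> (\<lambda>x. (\<gamma> * 2 ^ m) *\<^sub>R x + t) ` digit_set w" by blast
    show "dist y (v + (\<gamma> / 2 ^ q) *\<^sub>R u) \<le> CARD('n) * (2 / 2 ^ q)"
    proof (rule dist_le_of_components)
      fix i
      have "y $ i - (v + (\<gamma> / 2 ^ q) *\<^sub>R u) $ i = \<gamma> / 2 ^ q * (binval (shift (m + q) (e i)) - binval (f i))"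
        using binval_split[of "e i" "m + q"] by (simp add: ye v_def u power_add field_simps)
      then have "\<bar>y $ i - (v + (\<gamma> / 2 ^ q) *\<^sub>R u) $ i\<bar> = \<gamma> / 2 ^ q * \<bar>binval (shift (m + q) (e i)) - binval (f i)\<bar>"
        using \<gamma> by (simp add: abs_mult)
      also have "\<dots> \<le> 2 / 2 ^ q * 1"
      proof (intro mult_mono)
        show "\<bar>binval (shift (m + q) (e i)) - binval (f i)\<bar> \<le> 1"
          using binval_nonneg[of "f i"] binval_le_1[of "f i"]
            binval_nonneg[of "shift (m + q) (e i)"] binval_le_1[of "shift (m + q) (e i)"] by linarith
      qed (use \<gamma> in \<open>auto simp: divide_right_mono\<close>)
      finally show "\<bar>y $ i - (v + (\<gamma> / 2 ^ q) *\<^sub>R u) $ i\<bar> \<le> 2 / 2 ^ q" by simp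
    qed
  qed
  then show ?thesis by blast
qed

lemma near_point_of_hausdorff_dist:
  fixes D E :: "'a::heine_borel set"
  assumes "compact D" "compact E" "D \<noteq> {}" "x \<in> E" "hausdorff_dist D E < r"
  obtains y where "y \<in> D" "dist x y < r"
proof -
  obtain y where "y \<in> D" "infdist x D = dist x y"
    using infdist_attains_inf[of D x] assms compact_imp_closed by blast
  then show ?thesis using that infdist_le_hausdorff_dist(2)[OF assms(1,2,4)] assms(5) by force
qed

text \<open>
  Scales are normalised to \<open>\<gamma> * 2 ^ m\<close> with \<open>\<gamma>\<close> in a compact interval, so that the factors \<open>\<gamma> k\<close>
  have convergent subsequences and only the exponents \<open>m k\<close> interact with the digits.
\<close>

locale zoom =
  fixes w w' :: "nat \<Rightarrow> bool" and D :: "nat \<Rightarrow> (real ^ 'n::finite) set" and E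
    and \<gamma> :: "nat \<Rightarrow> real" and m :: "nat \<Rightarrow> nat" and t :: "nat \<Rightarrow> real ^ 'n"
  assumes E: "E \<in> hyperspace unit_cube" and D: "\<And>k. D k \<in> hyperspace unit_cube"
    and D_eq: "\<And>k. D k = (\<lambda>x. (\<gamma> k * 2 ^ m k) *\<^sub>R x + t k) ` digit_set w \<inter> unit_cube"
    and \<gamma>: "\<And>k. 1 \<le> \<gamma> k" "\<And>k. \<gamma> k \<le> 2"
    and DE: "(\<lambda>k. hausdorff_dist (D k) E) \<longlonglongrightarrow> 0"
    and w': "\<And>l. \<forall>\<^sub>F k in sequentially. w (m k + l) = w' l"
begin

lemma compact_ED: "compact E" "compact (D k)" "D k \<noteq> {}" "E \<noteq> {}"
  using E D[of k] by (auto simp: hyperspace_def)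

lemma limit_cover:
  "\<exists>Y. finite Y \<and> card Y \<le> (3 * 2 ^ ones_below w' q) ^ CARD('n) \<and>
    E \<subseteq> (\<Union>y\<in>Y. cball y ((2 * CARD('n) + 1) / 2 ^ q))"
proof -
  have "\<forall>\<^sub>F k in sequentially. \<forall>l<q. w (m k + l) = w' l"
    by (rule eventually_agree_below) (rule w')
  moreover have "\<forall>\<^sub>F k in sequentially. hausdorff_dist (D k) E < 1 / 2 ^ q"
    using DE by (rule order_tendstoD) simp
  ultimately have "\<forall>\<^sub>F k in sequentially. (\<forall>l<q. w (m k + l) = w' l) \<and> hausdorff_dist (D k) E < 1 / 2 ^ q"
    by (rule eventually_conj)
  then obtain k where k: "\<forall>l<q. w (m k + l) = w' l" "hausdorff_dist (D k) E < 1 / 2 ^ q"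
    using eventually_happens sequentially_bot by blast
  obtain Y where Y: "finite Y" "card Y \<le> (3 * 2 ^ ones_below (shift (m k) w) q) ^ CARD('n)"
    "\<And>x. x \<in> D k \<Longrightarrow> \<exists>y\<in>Y. dist x y \<le> CARD('n) * (2 / 2 ^ q)"
    using miniset_cover[OF \<gamma>(1,2)[of k], of "m k" w q "t k"] unfolding D_eq by blast
  have "ones_below (shift (m k) w) q = ones_below w' q"
    using k(1) by (intro ones_below_cong) (simp add: shift_def)
  moreover have "E \<subseteq> (\<Union>y\<in>Y. cball y ((2 * CARD('n) + 1) / 2 ^ q))"
  proof
    fix x assume "x \<in> E"
    from near_point_of_hausdorff_dist[OF compact_ED(2,1,3) this k(2)]
    obtain a where a: "a \<in> D k" "dist x a < 1 / 2 ^ q" by blast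
    from Y(3)[OF a(1)] obtain y where y: "y \<in> Y" "dist a y \<le> CARD('n) * (2 / 2 ^ q)" by blast
    have "dist y x \<le> dist a y + dist x a" using dist_triangle[of y x a] by (simp add: dist_commute)
    also have "\<dots> \<le> CARD('n) * (2 / 2 ^ q) + 1 / 2 ^ q" using a y by linarith
    also have "\<dots> = (2 * CARD('n) + 1) / 2 ^ q" by (simp add: field_simps)
    finally show "x \<in> (\<Union>y\<in>Y. cball y ((2 * CARD('n) + 1) / 2 ^ q))" using y(1) by auto
  qed
  ultimately show ?thesis using Y by auto
qed

text \<open>
  Near an interior point the minisets contain complete pieces at a fixed small size
  \<open>\<gamma> k / 2 ^ q\<close>, with no part cut off by the cube. Positions and sizes of these pieces range over a
  compact set, so that along a subsequence the pieces converge to a copy in \<open>E\<close>.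
\<close>

lemma limit_contains_copy:
  assumes "x \<in> E" "x \<in> interior unit_cube"
  obtains v c q where "0 < c" "(\<lambda>u. v + c *\<^sub>R u) ` digit_set (shift q w') \<subseteq> E"
proof -
  obtain \<rho> where \<rho>: "0 < \<rho>" "ball x \<rho> \<subseteq> unit_cube"
    using assms(2) unfolding mem_interior by blast
  obtain q where "(1/2) ^ q < \<rho> / 2 / (2 * CARD('n))"
    using real_arch_pow_inv[of "\<rho> / 2 / (2 * CARD('n))" "1/2"] \<rho> by auto
  then have q: "CARD('n) * (2 / 2 ^ q) < \<rho> / 2" by (simp add: field_simps power_one_over)
  have "\<forall>\<^sub>F k in sequentially. hausdorff_dist (D k) E < \<rho> / 2"
    using DE \<rho> by (intro order_tendstoD) auto
  then obtain k0 where k0: "\<And>k. k0 \<le> k \<Longrightarrow> hausdorff_dist (D k) E < \<rho> / 2"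
    by (auto simp: eventually_sequentially)
  have "\<exists>v. \<forall>u \<in> digit_set (shift (m k + q) w). v + (\<gamma> k / 2 ^ q) *\<^sub>R u \<in> D k \<and>
      v + (\<gamma> k / 2 ^ q) *\<^sub>R u \<in> ball x \<rho>" if "k0 \<le> k" for k
  proof -
    from near_point_of_hausdorff_dist[OF compact_ED(2,1,3) assms(1) k0[OF that]]
    obtain y where y: "y \<in> D k" "dist x y < \<rho> / 2" by blast
    from y(1) obtain v where v: "\<And>u. u \<in> digit_set (shift (m k + q) w) \<Longrightarrow>
        v + (\<gamma> k / 2 ^ q) *\<^sub>R u \<in> (\<lambda>x. (\<gamma> k * 2 ^ m k) *\<^sub>R x + t k) ` digit_set w \<and>
        dist y (v + (\<gamma> k / 2 ^ q) *\<^sub>R u) \<le> CARD('n) * (2 / 2 ^ q)"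
      using copy_around_point[OF \<gamma>(1,2)[of k], of y "m k" "t k" w q] unfolding D_eq by blast
    have "v + (\<gamma> k / 2 ^ q) *\<^sub>R u \<in> ball x \<rho>" if "u \<in> digit_set (shift (m k + q) w)" for u
      using v[OF that] y(2) q dist_triangle[of x "v + (\<gamma> k / 2 ^ q) *\<^sub>R u" y] by simp
    then show ?thesis using v \<rho>(2) unfolding D_eq by blast
  qed
  then obtain v where v: "\<And>k u. k0 \<le> k \<Longrightarrow> u \<in> digit_set (shift (m k + q) w) \<Longrightarrow> v k + (\<gamma> k / 2 ^ q) *\<^sub>R u \<in> D k"
    "\<And>k u. k0 \<le> k \<Longrightarrow> u \<in> digit_set (shift (m k + q) w) \<Longrightarrow> v k + (\<gamma> k / 2 ^ q) *\<^sub>R u \<in> ball x \<rho>"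
    by metis
  have inK: "\<forall>k. (v (k + k0), \<gamma> (k + k0)) \<in> cball x \<rho> \<times> {1..2}"
  proof
    fix k
    have "v (k + k0) + (\<gamma> (k + k0) / 2 ^ q) *\<^sub>R 0 \<in> ball x \<rho>"
      by (rule v(2)) (simp_all add: zero_in_digit_set)
    then show "(v (k + k0), \<gamma> (k + k0)) \<in> cball x \<rho> \<times> {1..2}" using \<gamma>[of "k + k0"] by simp
  qed
  have "seq_compact (cball x \<rho> \<times> {1..2::real})"
    unfolding compact_eq_seq_compact_metric[symmetric] by (intro compact_Times compact_cball compact_Icc)
  from this inK obtain p r where p2: "p \<in> cball x \<rho> \<times> {1..2}" and r: "strict_mono (r :: nat \<Rightarrow> nat)"
    and p1: "((\<lambda>k. (v (k + k0), \<gamma> (k + k0))) \<circ> r) \<longlonglongrightarrow> p"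
    by (rule seq_compactE)
  note p = p1 p2
  define R where "R k = r k + k0" for k
  have R: "strict_mono R" "\<And>k. k0 \<le> R k" using r by (auto simp: R_def strict_mono_def)
  have lim: "(\<lambda>k. v (R k)) \<longlonglongrightarrow> fst p" "(\<lambda>k. \<gamma> (R k)) \<longlonglongrightarrow> snd p"
    using tendsto_fst[OF p(1)] tendsto_snd[OF p(1)] by (simp_all add: o_def R_def)
  have DER: "(\<lambda>k. hausdorff_dist (D (R k)) E) \<longlonglongrightarrow> 0"
    using LIMSEQ_subseq_LIMSEQ[OF DE R(1)] by (simp add: o_def)
  have "fst p + (snd p / 2 ^ q) *\<^sub>R u \<in> E" if "u \<in> digit_set (shift q w')" for u
  proof -
    from digit_setD[OF that] obtain f where f: "\<forall>i l. f i l \<longrightarrow> shift q w' l"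
      and u: "u = (\<chi> i. binval (f i))" by (elim exE conjE)
    note f = f[rule_format]
    define a where "a k = (\<chi> i. binval (\<lambda>l. f i l \<and> shift (m (R k) + q) w l) :: real ^ 'n)" for k
    have a: "a k \<in> digit_set (shift (m (R k) + q) w)" for k
      unfolding a_def by (rule digit_setI) simp
    have "a \<longlonglongrightarrow> u" unfolding u
    proof (rule vec_tendstoI)
      fix i
      have "\<forall>\<^sub>F k in sequentially. (f i l \<and> shift (m (R k) + q) w l) = f i l" for l
        using eventually_subseq[OF R(1) w'[of "q + l"]]
        by eventually_elim (use f[of i l] in \<open>auto simp: shift_def add.assoc\<close>)
      then show "(\<lambda>k. a k $ i) \<longlonglongrightarrow> (\<chi> i. binval (f i)) $ i"
        unfolding a_def vec_lambda_beta by (rule tendsto_binval)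
    qed
    then have "(\<lambda>k. v (R k) + (\<gamma> (R k) / 2 ^ q) *\<^sub>R a k) \<longlonglongrightarrow> fst p + (snd p / 2 ^ q) *\<^sub>R u"
      by (intro tendsto_intros lim) auto
    then have "(\<lambda>k. infdist (v (R k) + (\<gamma> (R k) / 2 ^ q) *\<^sub>R a k) E) \<longlonglongrightarrow> infdist (fst p + (snd p / 2 ^ q) *\<^sub>R u) E"
      by (rule tendsto_infdist)
    moreover have "infdist (v (R k) + (\<gamma> (R k) / 2 ^ q) *\<^sub>R a k) E \<le> hausdorff_dist (D (R k)) E" for k
      using v(1)[OF R(2) a] by (rule infdist_le_hausdorff_dist(1)[OF compact_ED(2,1)])
    ultimately have "infdist (fst p + (snd p / 2 ^ q) *\<^sub>R u) E \<le> 0"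
      using DER by (intro LIMSEQ_le) auto
    then show ?thesis
      using in_closed_iff_infdist_zero[OF compact_imp_closed[OF compact_ED(1)] compact_ED(4)] infdist_nonneg
      by (metis antisym)
  qed
  moreover have "0 < snd p / 2 ^ q" using p(2) by (auto simp: mem_Times_iff)
  ultimately show ?thesis using that[of "snd p / 2 ^ q" "fst p" q] by blast
qed

text \<open>
  Upper and lower bound refer to the same sequence \<open>w'\<close>: discarding the first \<open>q\<close> places
  changes the numbers of ones by a constant at most.
\<close>

lemma limit_dimension:
  assumes meets: "E \<inter> interior unit_cube \<noteq> {}"
    and dens: "lower_density (ones_below w') s" "0 \<le> s"
  shows "hausdorff_dim E = ereal (real CARD('n) * s)"
proof (rule hausdorff_dim_eqI)
  let ?d = "real CARD('n)"
  have d: "0 < ?d" by simp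
  show "E \<noteq> {}" by (rule compact_ED)
  show "0 \<le> ?d * s" using dens by simp
  show "hausdorff_measure \<sigma> E = 0" if \<sigma>: "?d * s < \<sigma>" for \<sigma>
  proof -
    obtain \<tau> where \<tau>: "?d * s < \<tau>" "\<tau> < \<sigma>" using dense[OF \<sigma>] by blast
    have "0 \<le> ?d * s" using dens by simp
    then have "0 < \<sigma>" using \<sigma> by linarith
    have "s < \<tau> / ?d" using \<tau> by (simp add: field_simps)
    then have "\<exists>\<^sub>F q in sequentially. ones_below w' q \<le> \<tau> / ?d * real q"
      using dens unfolding lower_density_def by blast
    then have "\<exists>\<^sub>F q in sequentially. \<exists>\<U>. finite \<U> \<and> E \<subseteq> \<Union>\<U> \<and>
        (\<forall>U\<in>\<U>. bounded U \<and> diameter U \<le> 2 * (2 * ?d + 1) / 2 ^ q) \<and>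
        real (card \<U>) \<le> 3 ^ CARD('n) * 2 powr (\<tau> * real q)"
    proof (rule frequently_elim1)
      fix q assume q: "real (ones_below w' q) \<le> \<tau> / ?d * real q"
      obtain Y where Y: "finite Y" "card Y \<le> (3 * 2 ^ ones_below w' q) ^ CARD('n)"
        "E \<subseteq> (\<Union>y\<in>Y. cball y ((2 * CARD('n) + 1) / 2 ^ q))"
        using limit_cover by blast
      let ?U = "(\<lambda>y. cball y ((2 * CARD('n) + 1) / 2 ^ q)) ` Y"
      have "real (card ?U) \<le> real ((3 * 2 ^ ones_below w' q) ^ CARD('n))"
        using card_image_le[OF Y(1), of "\<lambda>y. cball y ((2 * CARD('n) + 1) / 2 ^ q)"] Y(2) by (intro of_nat_mono) linarith
      also have "\<dots> = 3 ^ CARD('n) * 2 powr (real (ones_below w' q) * ?d)"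
        by (simp add: power_mult_distrib powr_powr flip: powr_realpow)
      also have "\<dots> \<le> 3 ^ CARD('n) * 2 powr (\<tau> * real q)"
        using q d by (intro mult_left_mono powr_mono) (auto simp: field_simps)
      finally have "real (card ?U) \<le> 3 ^ CARD('n) * 2 powr (\<tau> * real q)" .
      then show "\<exists>\<U>. finite \<U> \<and> E \<subseteq> \<Union>\<U> \<and>
        (\<forall>U\<in>\<U>. bounded U \<and> diameter U \<le> 2 * (2 * ?d + 1) / 2 ^ q) \<and>
        real (card \<U>) \<le> 3 ^ CARD('n) * 2 powr (\<tau> * real q)"
        using Y by (intro exI[of _ ?U]) (auto simp: diameter_cball add.commute)
    qed
    then show ?thesis
      by (intro hausdorff_measure_eq_0_of_covers[OF \<open>0 < \<sigma>\<close> \<tau>(2), of "2 * (2 * ?d + 1)" "3 ^ CARD('n)"]) auto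
  qed
  show "hausdorff_measure \<sigma> E \<noteq> 0" if \<sigma>: "0 < \<sigma>" "\<sigma> < ?d * s" for \<sigma>
  proof -
    obtain x where "x \<in> E" "x \<in> interior unit_cube" using meets by blast
    then obtain v c q where c: "0 < c" "(\<lambda>u. v + c *\<^sub>R u) ` digit_set (shift q w') \<subseteq> E"
      by (rule limit_contains_copy)
    have "\<sigma> / ?d < s" using \<sigma> by (simp add: field_simps)
    then obtain y where y: "\<sigma> / ?d < y" "y < s" using dense by blast
    have "0 \<le> y" using y \<sigma> by (smt (verit) divide_pos_pos d)
    have "\<forall>\<^sub>F n in sequentially. \<sigma> * real n \<le> ?d * real (ones_below (shift q w') n)"
    proof -
      have "\<forall>\<^sub>F u in sequentially. y * real u \<le> ones_below w' u"
        using dens y by (simp add: lower_density_def)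
      then have "\<forall>\<^sub>F n in sequentially. y * real (n + q) \<le> ones_below w' (n + q)"
        by (rule eventually_sequentially_seg[THEN iffD2])
      moreover have "\<forall>\<^sub>F n in sequentially. real (ones_below w' q) \<le> (y - \<sigma> / ?d) * real n"
        using y by (intro eventually_const_le_mult) simp
      ultimately show ?thesis
      proof eventually_elim
        case (elim n)
        have "\<sigma> / ?d * n \<le> y * real n - ones_below w' q" using elim(2) by (simp add: left_diff_distrib)
        also have "\<dots> \<le> y * real (n + q) - ones_below w' q" using \<open>0 \<le> y\<close> by (simp add: distrib_left)
        also have "\<dots> \<le> real (ones_below (shift q w') n)"
          using elim(1) ones_below_add[of w' q n] by (simp add: add.commute)
        finally have "?d * (\<sigma> / ?d * n) \<le> ?d * real (ones_below (shift q w') n)" by (rule mult_left_mono) simp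
        then show ?case by simp
      qed
    qed
    then show ?thesis
      by (rule hausdorff_measure_pos_of_copy[OF compact_ED(1) c \<sigma>(1)])
  qed
qed

end

text \<open>
  The integer parts of \<open>2 ^ m *\<^sub>R x\<close> other than \<open>0\<close> are moved out of the cube by the
  translation. The translation by half the side puts the corner into the interior of the cube.
\<close>

lemma digit_set_zoom:
  "(\<lambda>x. 2 ^ m *\<^sub>R x + (\<chi> i. 1/2)) ` digit_set w \<inter> unit_cube =
   (\<lambda>x. x + (\<chi> i. 1/2)) ` digit_set (shift m w) \<inter> (unit_cube :: (real ^ 'n::finite) set)"
proof (intro equalityI subsetI)
  fix x :: "real ^ 'n" assume x: "x \<in> (\<lambda>x. 2 ^ m *\<^sub>R x + (\<chi> i. 1/2)) ` digit_set w \<inter> unit_cube"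
  then obtain e where e: "\<And>i l. e i l \<Longrightarrow> w l" and xe: "x = 2 ^ m *\<^sub>R (\<chi> i. binval (e i)) + (\<chi> i. 1/2)"
    by (auto elim!: digit_setE)
  have "x $ i = binval (shift m (e i)) + 1/2" for i
  proof -
    obtain a where a: "2 ^ m * bintrunc m (e i) = real a" using bintrunc_dyadic by blast
    have xi: "x $ i = a + binval (shift m (e i)) + 1/2"
      using binval_split[of "e i" m] by (simp add: xe algebra_simps flip: a)
    moreover have "x $ i \<le> 1" using x by (auto simp: mem_box_cart)
    ultimately have "real a < 1" using binval_nonneg[of "shift m (e i)"] by linarith
    then show ?thesis using xi by simp
  qed
  then have "x = (\<chi> i. binval (shift m (e i))) + (\<chi> i. 1/2)" by (simp add: vec_eq_iff)
  moreover have "(\<chi> i. binval (shift m (e i))) \<in> digit_set (shift m w)"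
    using e by (intro digit_setI) (simp add: shift_def)
  ultimately show "x \<in> (\<lambda>x. x + (\<chi> i. 1/2)) ` digit_set (shift m w) \<inter> unit_cube" using x by blast
next
  fix x :: "real ^ 'n" assume x: "x \<in> (\<lambda>x. x + (\<chi> i. 1/2)) ` digit_set (shift m w) \<inter> unit_cube"
  then obtain e where e: "\<And>i l. e i l \<Longrightarrow> shift m w l" and xe: "x = (\<chi> i. binval (e i)) + (\<chi> i. 1/2)"
    by (auto elim!: digit_setE)
  define g where "g i = (\<lambda>l. if l < m then False else e i (l - m))" for i
  have "w l" if "g i l" for i l
    using that e[of i "l - m"] by (auto simp: g_def shift_def split: if_splits)
  then have "(\<chi> i. binval (g i)) \<in> digit_set w" by (rule digit_setI)
  moreover have "x = 2 ^ m *\<^sub>R (\<chi> i. binval (g i)) + (\<chi> i. 1/2)"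
    using binval_append[of m "\<lambda>l. False"] by (simp add: xe vec_eq_iff g_def bintrunc_def)
  ultimately show "x \<in> (\<lambda>x. 2 ^ m *\<^sub>R x + (\<chi> i. 1/2)) ` digit_set w \<inter> unit_cube" using x by blast
qed

definition corner_view :: "(nat \<Rightarrow> bool) \<Rightarrow> (real ^ 'n) set" where
  "corner_view w = (\<lambda>x. x + (\<chi> i. 1/2)) ` digit_set w \<inter> unit_cube"

lemma half_in_corner_view: "(\<chi> i. 1/2) \<in> (corner_view w :: (real ^ 'n::finite) set)"
  using zero_in_digit_set[of w] by (force simp: corner_view_def mem_box_cart image_iff)

lemma corner_view_in_hyperspace: "corner_view w \<in> hyperspace (unit_cube :: (real ^ 'n::finite) set)"
proof -
  have "compact (corner_view w :: (real ^ 'n) set)"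
    unfolding corner_view_def
    by (intro compact_Int_closed compact_continuous_image continuous_intros compact_digit_set closed_cbox)
  then show ?thesis using half_in_corner_view by (auto simp: hyperspace_def corner_view_def)
qed

text \<open>
  Truncation decreases the coordinates, hence the truncated point is not pushed out of the
  cube. For this reason cutting with the cube does not disturb the continuous dependence on \<open>w\<close>.
\<close>

lemma corner_view_truncate:
  assumes agree: "\<And>l. l < q \<Longrightarrow> w l = w' l" and x: "x \<in> (corner_view w :: (real ^ 'n::finite) set)"
  shows "\<exists>y \<in> corner_view w'. dist x y \<le> CARD('n) * (1 / 2 ^ q)"
proof -
  obtain e where e: "\<And>i l. e i l \<Longrightarrow> w l" and xe: "x = (\<chi> i. binval (e i)) + (\<chi> i. 1/2)"
    using x by (auto simp: corner_view_def elim!: digit_setE)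
  define y where "y = (\<chi> i. binval (\<lambda>l. l < q \<and> e i l)) + (\<chi> i. (1/2 :: real))"
  have yi: "y $ i = bintrunc q (e i) + 1/2" for i by (simp add: y_def binval_truncated)
  have "0 \<le> y $ i \<and> y $ i \<le> 1" for i
  proof -
    have "binval (e i) + 1/2 \<le> 1" using x by (auto simp: corner_view_def mem_box_cart xe)
    then show ?thesis using bintrunc_le_binval[of q "e i"] bintrunc_nonneg[of q "e i"] by (simp add: yi)
  qed
  then have "y \<in> unit_cube" by (simp add: mem_box_cart)
  moreover have "(\<chi> i. binval (\<lambda>l. l < q \<and> e i l)) \<in> digit_set w'"
    using e agree by (intro digit_setI) auto
  ultimately have "y \<in> corner_view w'" by (auto simp: corner_view_def y_def)
  moreover have "dist x y \<le> CARD('n) * (1 / 2 ^ q)"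
  proof (rule dist_le_of_components)
    fix i
    show "\<bar>x $ i - y $ i\<bar> \<le> 1 / 2 ^ q"
      using bintrunc_le_binval[of q "e i"] binval_le_bintrunc[of "e i" q] by (simp add: yi xe)
  qed
  ultimately show ?thesis by blast
qed

lemma corner_view_tendsto:
  assumes "\<And>l. \<forall>\<^sub>F k in sequentially. w (m k + l) = w' l"
  shows "(\<lambda>k. hausdorff_dist (corner_view (shift (m k) w)) (corner_view w' :: (real ^ 'n::finite) set)) \<longlonglongrightarrow> 0"
proof (rule tendstoI)
  fix \<epsilon> :: real assume "0 < \<epsilon>"
  obtain q where "(1/2) ^ q < \<epsilon> / CARD('n)"
    using real_arch_pow_inv[of "\<epsilon> / CARD('n)" "1/2"] \<open>0 < \<epsilon>\<close> by auto
  then have q: "CARD('n) * (1 / 2 ^ q) < \<epsilon>" by (simp add: field_simps power_one_over)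
  have "\<forall>\<^sub>F k in sequentially. \<forall>l<q. w (m k + l) = w' l"
    by (rule eventually_agree_below) (rule assms)
  then show "\<forall>\<^sub>F k in sequentially. dist (hausdorff_dist (corner_view (shift (m k) w)) (corner_view w' :: (real ^ 'n) set)) 0 < \<epsilon>"
  proof eventually_elim
    case (elim k)
    let ?A = "corner_view (shift (m k) w) :: (real ^ 'n) set" and ?B = "corner_view w' :: (real ^ 'n) set"
    have "hausdorff_dist ?A ?B \<le> CARD('n) * (1 / 2 ^ q)"
      using half_in_corner_view elim
      by (intro hausdorff_dist_le corner_view_truncate) (auto simp: shift_def)
    moreover have "0 \<le> hausdorff_dist ?A ?B"
    proof -
      have "compact ?A" "compact ?B"
        using corner_view_in_hyperspace by (auto simp: hyperspace_def)
      from infdist_le_hausdorff_dist(1)[OF this half_in_corner_view]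
      show ?thesis using infdist_nonneg[of "\<chi> i. 1/2" ?B] by linarith
    qed
    ultimately show ?case using q by (simp add: dist_real_def)
  qed
qed

text \<open>
  The scales of the minisets may stay bounded; then \<open>w'\<close> is itself a shift of \<open>w\<close>. This is the
  reason why the lower density of \<open>w\<close> has to be controlled as well.
\<close>

lemma gallery_digit_set_dim:
  fixes E :: "(real ^ 'n::finite) set"
  assumes E: "E \<in> gallery (digit_set w)"
  shows "\<exists>m w'. (\<forall>l. \<forall>\<^sub>F k in sequentially. w (m k + l) = w' l) \<and>
    (\<forall>s. lower_density (ones_below w') s \<longrightarrow> 0 \<le> s \<longrightarrow> hausdorff_dim E = ereal (real CARD('n) * s))"
proof -
  obtain D where EX: "E \<in> hyperspace unit_cube" "E \<inter> interior unit_cube \<noteq> {}"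
    and D: "\<And>k. D k \<in> minisets (digit_set w)" "(\<lambda>k. hausdorff_dist (D k) E) \<longlonglongrightarrow> 0"
    using E unfolding gallery_def microsets_def by blast
  have DX: "D k \<in> hyperspace unit_cube" for k using D(1)[of k] by (simp add: minisets_def)
  have "\<exists>\<gamma> m t. 1 \<le> \<gamma> \<and> \<gamma> \<le> 2 \<and> D k = (\<lambda>x. (\<gamma> * 2 ^ m) *\<^sub>R x + t) ` digit_set w \<inter> unit_cube" for k
  proof -
    obtain c t where c: "1 \<le> c" "D k = (\<lambda>x. c *\<^sub>R x + t) ` digit_set w \<inter> unit_cube"
      using D(1)[of k] unfolding minisets_def by blast
    obtain m where m: "2 ^ m \<le> c" "c < 2 ^ Suc m" using dyadic_scale[OF c(1)] by blast
    then have "1 \<le> c / 2 ^ m" "c / 2 ^ m \<le> 2" "c / 2 ^ m * 2 ^ m = c" by (simp_all add: field_simps)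
    then show ?thesis using c(2) by metis
  qed
  then obtain \<gamma> m t where \<gamma>: "\<And>k. 1 \<le> \<gamma> k" "\<And>k. \<gamma> k \<le> 2"
    and Dk: "\<And>k. D k = (\<lambda>x. (\<gamma> k * 2 ^ m k) *\<^sub>R x + t k) ` digit_set w \<inter> unit_cube" by metis
  obtain r w' where r: "strict_mono (r :: nat \<Rightarrow> nat)"
    and lim: "\<And>l. \<forall>\<^sub>F k in sequentially. shift (m (r k)) w l = w' l"
    using bool_sequences_subseq[of "\<lambda>k. shift (m k) w"] by blast
  have lim': "\<forall>\<^sub>F k in sequentially. w (m (r k) + l) = w' l" for l
    using lim[of l] by (simp add: shift_def)
  interpret zoom w w' "\<lambda>k. D (r k)" E "\<lambda>k. \<gamma> (r k)" "\<lambda>k. m (r k)" "\<lambda>k. t (r k)"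
  proof
    show "(\<lambda>k. hausdorff_dist (D (r k)) E) \<longlonglongrightarrow> 0"
      using LIMSEQ_subseq_LIMSEQ[OF D(2) r] by (simp add: o_def)
  qed (fact EX DX \<gamma> Dk lim')+
  show ?thesis
    using lim' limit_dimension[OF EX(2)] by (intro exI[of _ "\<lambda>k. m (r k)"] exI[of _ w']) simp
qed

lemma gallery_digit_set_attains:
  assumes lim: "\<And>l. \<forall>\<^sub>F k in sequentially. w (m k + l) = w' l"
    and "lower_density (ones_below w') s" "0 \<le> s"
  shows "\<exists>E \<in> gallery (digit_set w :: (real ^ 'n::finite) set). hausdorff_dim E = ereal (real CARD('n) * s)"
proof
  let ?E = "corner_view w' :: (real ^ 'n) set" and ?D = "\<lambda>k. corner_view (shift (m k) w) :: (real ^ 'n) set"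
  have D: "?D k = (\<lambda>x. 2 ^ m k *\<^sub>R x + (\<chi> i. 1/2)) ` digit_set w \<inter> unit_cube" for k
    unfolding corner_view_def digit_set_zoom ..
  have meets: "?E \<inter> interior unit_cube \<noteq> {}"
  proof -
    have "(\<chi> i. (1/2 :: real)) \<in> interior (unit_cube :: (real ^ 'n) set)"
      by (simp add: interior_cbox mem_box_cart)
    then show ?thesis using half_in_corner_view by blast
  qed
  have "?D k \<in> minisets (digit_set w)" for k
    unfolding minisets_def mem_Collect_eq
  proof (intro conjI exI)
    show "?D k \<in> hyperspace unit_cube" by (rule corner_view_in_hyperspace)
    show "(1::real) \<le> 2 ^ m k" by simp
    show "?D k = (\<lambda>x. 2 ^ m k *\<^sub>R x + (\<chi> i. 1/2)) ` digit_set w \<inter> unit_cube" by (rule D)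
  qed
  then show "?E \<in> gallery (digit_set w)"
    unfolding gallery_def microsets_def mem_Collect_eq
    by (intro conjI exI[of _ ?D] allI corner_view_tendsto[OF lim] corner_view_in_hyperspace meets)
  interpret zoom w w' ?D ?E "\<lambda>k. 1" m "\<lambda>k. \<chi> i. 1/2"
  proof
    show "?D k = (\<lambda>x. (1 * 2 ^ m k) *\<^sub>R x + (\<chi> i. 1/2)) ` digit_set w \<inter> unit_cube" for k
      using D[of k] by (simp only: mult_1)
    show "(\<lambda>k. hausdorff_dist (?D k) ?E) \<longlonglongrightarrow> 0" by (rule corner_view_tendsto[OF lim])
  qed (simp_all add: corner_view_in_hyperspace lim)
  show "hausdorff_dim ?E = ereal (real CARD('n) * s)"
    by (rule limit_dimension[OF meets assms(2,3)])
qed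

section \<open>The set of dimensions\<close>

theorem theorem1p3:
  fixes \<Delta> :: "real set"
  assumes "\<Delta> \<subseteq> {0..real CARD('n::finite)}"
    and "\<Delta> \<noteq> {}"
    and "fsigma \<Delta>"
    and "Inf \<Delta> \<in> \<Delta>"
    and "Sup \<Delta> \<in> \<Delta>"
  shows "\<exists>F :: (real ^ 'n) set. compact F \<and> F \<subseteq> unit_cube \<and>
           {hausdorff_dim E | E. E \<in> gallery F} = ereal ` \<Delta>"
proof -
  let ?d = "real CARD('n)"
  have d: "0 < ?d" by simp
  obtain C :: "nat \<Rightarrow> real set" where C: "\<And>p. closed (C p)" "\<Delta> = (\<Union>p. C p)"
    using \<open>fsigma \<Delta>\<close> by (auto elim!: fsigma.cases)
  \<comment> \<open>the dimension of a microset is \<open>d\<close> times a lower density\<close>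
  define K where "K p = (\<lambda>x. ?d * x) -` C p" for p
  have K: "x \<in> (\<Union>p. K p) \<longleftrightarrow> ?d * x \<in> \<Delta>" for x by (simp add: K_def C(2))
  have bdd: "bdd_below \<Delta>" "bdd_above \<Delta>"
    by (rule bdd_below_mono[OF bdd_below_Icc assms(1)], rule bdd_above_mono[OF bdd_above_Icc assms(1)])
  obtain w where
    w1: "\<And>m w'. (\<And>l. \<forall>\<^sub>F k in sequentially. w (m k + l) = w' l) \<Longrightarrow> \<exists>t \<in> (\<Union>p. K p). lower_density (ones_below w') t" and
    w2: "\<And>t. t \<in> (\<Union>p. K p) \<Longrightarrow>
      \<exists>m w'. (\<forall>l. \<forall>\<^sub>F k in sequentially. w (m k + l) = w' l) \<and> lower_density (ones_below w') t"
  proof (rule sequence_with_limit_densities[of K "Inf \<Delta> / ?d" "Sup \<Delta> / ?d"])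
    show "closed (K p)" for p
      unfolding K_def by (intro continuous_closed_vimage C continuous_intros)
    show "0 \<le> Inf \<Delta> / ?d" using assms by auto
    show "Sup \<Delta> / ?d \<le> 1" using assms(1,5) d by (auto simp: field_simps)
    show "Inf \<Delta> / ?d \<in> (\<Union>p. K p)" "Sup \<Delta> / ?d \<in> (\<Union>p. K p)" unfolding K using assms by simp_all
    show "(\<Union>p. K p) \<subseteq> {Inf \<Delta> / ?d..Sup \<Delta> / ?d}"
    proof
      fix x assume "x \<in> (\<Union>p. K p)"
      then have "?d * x \<in> \<Delta>" by (simp only: K)
      then have "Inf \<Delta> \<le> ?d * x" "?d * x \<le> Sup \<Delta>" using bdd by (auto intro: cInf_lower cSup_upper)
      then show "x \<in> {Inf \<Delta> / ?d..Sup \<Delta> / ?d}" using d by (simp add: field_simps)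
    qed
  qed blast
  have K0: "0 \<le> s" if "s \<in> (\<Union>p. K p)" for s
    using that assms(1) d unfolding K by (auto simp: zero_le_mult_iff)
  let ?F = "digit_set w :: (real ^ 'n) set"
  have "{hausdorff_dim E | E. E \<in> gallery ?F} = ereal ` \<Delta>"
  proof (intro equalityI subsetI)
    fix h assume "h \<in> {hausdorff_dim E | E. E \<in> gallery ?F}"
    then obtain E where E: "E \<in> gallery ?F" "h = hausdorff_dim E" by blast
    from gallery_digit_set_dim[OF E(1)] obtain m w' where lim: "\<And>l. \<forall>\<^sub>F k in sequentially. w (m k + l) = w' l"
      and dim: "\<And>s. lower_density (ones_below w') s \<Longrightarrow> 0 \<le> s \<Longrightarrow> hausdorff_dim E = ereal (?d * s)"
      by metis
    from w1[OF lim] obtain s where s: "s \<in> (\<Union>p. K p)" "lower_density (ones_below w') s" by blast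
    have "h = ereal (?d * s)" using dim[OF s(2) K0[OF s(1)]] E(2) by simp
    moreover have "?d * s \<in> \<Delta>" using s(1) by (simp only: K)
    ultimately show "h \<in> ereal ` \<Delta>" by blast
  next
    fix h assume "h \<in> ereal ` \<Delta>"
    then obtain x where x: "x \<in> \<Delta>" "h = ereal x" by blast
    have xd: "x / ?d \<in> (\<Union>p. K p)" unfolding K using x by simp
    from w2[OF this] obtain m w' where "\<And>l. \<forall>\<^sub>F k in sequentially. w (m k + l) = w' l"
      "lower_density (ones_below w') (x / ?d)" by blast
    from gallery_digit_set_attains[OF this K0[OF xd], where 'n = 'n]
    obtain E :: "(real ^ 'n) set" where E: "E \<in> gallery ?F" "hausdorff_dim E = ereal (?d * (x / ?d))" ..
    have "?d * (x / ?d) = x" by simp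
    then have "h = hausdorff_dim E" using x E(2) by metis
    with E(1) show "h \<in> {hausdorff_dim E | E. E \<in> gallery ?F}" by (intro CollectI exI conjI)
  qed
  then show ?thesis
    by (intro exI[of _ ?F] conjI compact_digit_set digit_set_subset)
qed

end
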